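(* Let $H$ satisfy the standing assumptions (i)--(iv) of the context, let $u_0:\mathbb{R}^d\to\mathbb{R}$ be bounded and uniformly continuous, and assume $\mathcal{H}=\mathbb{R}^d$, where $$\mathcal{H}=\Big\{p\in\mathbb{R}^d:\ \overline{H}(p)=\min_{q\in\mathbb{R}^d}\overline{H}(q)\ \text{ or }\ p\in\partial\left(\{q: \overline{H}(q)\leq\overline{H}(p)\}\right)\cap\partial\left(\mathrm{Conv}\left(\{q: \overline{H}(q)\leq\overline{H}(p)\}\right)\right)\Big\}.$$ For each $\omega\in\Omega_6$ (the set of full probability fixed in the context), let $u^\epsilon$ denote the solution of $$u^\epsilon_t+H(Du^\epsilon,x/\epsilon,\omega)=0\ \text{ on }\ \mathbb{R}^d\times(0,\infty),\qquad u^\epsilon=u_0\ \text{ on }\ \mathbb{R}^d\times\{0\},$$ and let $\overline{u}$ denote the solution of $$\overline{u}_t+\overline{H}(D\overline{u})=0\ \text{ on }\ \mathbb{R}^d\times(0,\infty),\qquad \overline{u}=u_0\ \text{ on }\ \mathbb{R}^d\times\{0\}.$$ Then, as $\epsilon\to0$, $u^\epsilon\to\overline{u}$ locally uniformly on $\mathbb{R}^d\times[0,\infty)$.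
   Context: Setting. $(\Omega,\mathcal{F},\mathbb{P})$ is a probability space equipped with a group $\{\tau_y\}_{y\in\mathbb{R}^d}$ of transformations $\tau_y:\Omega\to\Omega$ (so $\tau_{y+z}=\tau_y\tau_z$) which are measure-preserving and ergodic, the latter meaning that if $E\in\mathcal{F}$ satisfies $\tau_y(E)=E$ for every $y\in\mathbb{R}^d$ then $\mathbb{P}(E)\in\{0,1\}$. "Full probability" means probability one. $B_R$ is the open ball of radius $R$ centered at $0$ in $\mathbb{R}^d$. For $U\subset\mathbb{R}^d$, $\partial U$ is its boundary and $\mathrm{Conv}(U)$ is the smallest closed convex set containing $U$. All partial differential equations and inequalities are understood in the viscosity sense. Standing assumptions on $H:\mathbb{R}^d\times\mathbb{R}^d\times\Omega\to\mathbb{R}$, $(p,y,\omega)\mapsto H(p,y,\omega)$ (measurable in $\omega$ for fixed $(p,y)$): (i) for each $p$, $(y,\omega)\mapsto H(p,y,\omega)$ is stationary: $H(p,y+z,\omega)=H(p,y,\tau_z\omega)$ for all $y,z\in\mathbb{R}^d$, $\omega\in\Omega$; (ii) $\lim_{|p|\to\infty}\inf_{(y,\omega)\in\mathbb{R}^d\times\Omega}H(p,y,\omega)=+\infty$; (iii) for each $R>0$ there is $C=C(R)>0$ with $|H(p,y,\omega)|\le C$ for all $p\in B_R$, $y\in\mathbb{R}^d$, $\omega\in\Omega$; (iv) for each $R>0$ there is $C=C(R)>0$ with $|H(p_1,y_1,\omega)-H(p_2,y_2,\omega)|\le C(|p_1-p_2|+|y_1-y_2|)$ for all $p_1,p_2\in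 B_R$, $y_1,y_2\in\mathbb{R}^d$, $\omega\in\Omega$. Approximate macroscopic problem. For $p\in\mathbb{R}^d$, $\delta>0$, $\omega\in\Omega$, $v^\delta=v^\delta(\cdot,\omega)$ (corresponding to $p$) is the unique bounded Lipschitz viscosity solution of $\delta v^\delta+H(p+Dv^\delta,x,\omega)=0$ on $\mathbb{R}^d$. Effective Hamiltonian. There is a set $\Omega_1\subset\Omega$ of full probability such that for each $p\in\mathbb{R}^d$ the quantity $\limsup_{\delta\to0}-\delta v^\delta(0,\omega)$ takes the same value for every $\omega\in\Omega_1$; this value is denoted $\overline{H}(p)$, defining $\overline{H}:\mathbb{R}^d\to\mathbb{R}$ (which is locally Lipschitz and coercive). The set $\Omega_6$. $\Omega_6\subset\Omega$ is a fixed set of full probability (it is known to exist) such that for every $\omega\in\Omega_6$, every $p\in\mathcal{H}$ and every $R>0$, with $v^\delta$ the solution corresponding to $p$, $\lim_{\delta\to0}\sup_{x\in B_{R/\delta}}|\overline{H}(p)+\delta v^\delta(x,\omega)|=0$. The solutions $u^\epsilon$ and $\overline{u}$ are the unique viscosity solutions that are bounded and uniformly continuous on $\mathbb{R}^d\times[0,T)$ for each $T>0$. *)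

theory Defs
  imports "HOL-Probability.Probability"
begin

locale ergodic_action = prob_space M
  for M :: "'w measure" and \<tau> :: "real ^ 'd \<Rightarrow> 'w \<Rightarrow> 'w" +
  assumes tau_zero: "\<And>\<omega>. \<omega> \<in> space M \<Longrightarrow> \<tau> 0 \<omega> = \<omega>"
    and tau_add: "\<And>y z \<omega>. \<omega> \<in> space M \<Longrightarrow> \<tau> (y + z) \<omega> = \<tau> y (\<tau> z \<omega>)"
    and tau_measurable: "\<And>y. \<tau> y \<in> measurable M M"
    and tau_preserving: "\<And>y. distr M M (\<tau> y) = M"
    and ergodic: "\<And>E. E \<in> sets M \<Longrightarrow> (\<And>y. \<tau> y ` E = E) \<Longrightarrow> measure M E \<in> {0, 1}"

locale random_hamiltonian = ergodic_action M \<tau>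
  for M :: "'w measure" and \<tau> :: "real ^ 'd \<Rightarrow> 'w \<Rightarrow> 'w" +
  fixes H :: "real ^ 'd \<Rightarrow> real ^ 'd \<Rightarrow> 'w \<Rightarrow> real"
  assumes H_measurable: "\<And>p y. H p y \<in> borel_measurable M"
    and H_stationary:
      "\<And>p y z \<omega>. \<omega> \<in> space M \<Longrightarrow> H p (y + z) \<omega> = H p y (\<tau> z \<omega>)"
    and H_coercive:
      "((\<lambda>p. INF (y, \<omega>) \<in> UNIV \<times> space M. ereal (H p y \<omega>)) \<longlongrightarrow> \<infinity>) at_infinity"
    and H_bounded:
      "\<And>R. R > 0 \<Longrightarrow> \<exists>C>0. \<forall>p\<in>ball 0 R. \<forall>y. \<forall>\<omega>\<in>space M. \<bar>H p y \<omega>\<bar> \<le> C"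
    and H_lipschitz:
      "\<And>R. R > 0 \<Longrightarrow> \<exists>C>0. \<forall>p1\<in>ball 0 R. \<forall>p2\<in>ball 0 R. \<forall>y1 y2. \<forall>\<omega>\<in>space M.
         \<bar>H p1 y1 \<omega> - H p2 y2 \<omega>\<bar> \<le> C * (norm (p1 - p2) + norm (y1 - y2))"

text \<open>
  Viscosity sub- and supersolutions of \<open>F x (u x) (D u x) = 0\<close> on an open set \<open>U\<close>, with
  \<open>C\<^sup>1\<close> test functions touching at local extrema. The first conjunct is upper (lower)
  semicontinuity of \<open>u\<close> on \<open>U\<close>.
\<close>

definition viscosity_subsolution ::
    "'a::euclidean_space set \<Rightarrow> ('a \<Rightarrow> real \<Rightarrow> 'a \<Rightarrow> real) \<Rightarrow> ('a \<Rightarrow> real) \<Rightarrow> bool" where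
  "viscosity_subsolution U F u \<longleftrightarrow>
     (\<forall>x\<in>U. \<forall>a>u x. \<forall>\<^sub>F y in at x within U. u y < a) \<and>
     (\<forall>\<phi> D\<phi>. (\<forall>y\<in>U. GDERIV \<phi> y :> D\<phi> y) \<and> continuous_on U D\<phi> \<longrightarrow>
        (\<forall>x\<in>U. (\<forall>\<^sub>F y in at x within U. u y - \<phi> y \<le> u x - \<phi> x) \<longrightarrow> F x (u x) (D\<phi> x) \<le> 0))"

definition viscosity_supersolution ::
    "'a::euclidean_space set \<Rightarrow> ('a \<Rightarrow> real \<Rightarrow> 'a \<Rightarrow> real) \<Rightarrow> ('a \<Rightarrow> real) \<Rightarrow> bool" where
  "viscosity_supersolution U F u \<longleftrightarrow>
     (\<forall>x\<in>U. \<forall>a<u x. \<forall>\<^sub>F y in at x within U. a < u y) \<and>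
     (\<forall>\<phi> D\<phi>. (\<forall>y\<in>U. GDERIV \<phi> y :> D\<phi> y) \<and> continuous_on U D\<phi> \<longrightarrow>
        (\<forall>x\<in>U. (\<forall>\<^sub>F y in at x within U. u x - \<phi> x \<le> u y - \<phi> y) \<longrightarrow> 0 \<le> F x (u x) (D\<phi> x)))"

definition viscosity_solution ::
    "'a::euclidean_space set \<Rightarrow> ('a \<Rightarrow> real \<Rightarrow> 'a \<Rightarrow> real) \<Rightarrow> ('a \<Rightarrow> real) \<Rightarrow> bool" where
  "viscosity_solution U F u \<longleftrightarrow> viscosity_subsolution U F u \<and> viscosity_supersolution U F u"

definition approx_corrector ::
    "(real ^ 'd \<Rightarrow> real ^ 'd \<Rightarrow> 'w \<Rightarrow> real) \<Rightarrow> real ^ 'd \<Rightarrow> real \<Rightarrow> 'w \<Rightarrow> (real ^ 'd \<Rightarrow> real) \<Rightarrow> bool"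
  where
  "approx_corrector H p \<delta> \<omega> v \<longleftrightarrow>
     bounded (range v) \<and> (\<exists>L. L-lipschitz_on UNIV v) \<and>
     viscosity_solution UNIV (\<lambda>x r q. \<delta> * r + H (p + q) x \<omega>) v"

definition effective_hamiltonian ::
    "'w measure \<Rightarrow> (real ^ 'd \<Rightarrow> real \<Rightarrow> 'w \<Rightarrow> real ^ 'd \<Rightarrow> real) \<Rightarrow> (real ^ 'd \<Rightarrow> real) \<Rightarrow> bool" where
  "effective_hamiltonian M v Hbar \<longleftrightarrow>
     (\<exists>\<Omega>1\<in>sets M. measure M \<Omega>1 = 1 \<and>
        (\<forall>p. \<forall>\<omega>\<in>\<Omega>1. Limsup (at_right 0) (\<lambda>\<delta>. ereal (- \<delta> * v p \<delta> \<omega> 0)) = ereal (Hbar p)))"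

definition closed_convex_hull :: "(real ^ 'd) set \<Rightarrow> (real ^ 'd) set" where
  "closed_convex_hull U = (\<lambda>S. closed S \<and> convex S) hull U"

definition homogenizing_slopes :: "(real ^ 'd \<Rightarrow> real) \<Rightarrow> (real ^ 'd) set" where
  "homogenizing_slopes Hbar =
     {p. (\<forall>q. Hbar p \<le> Hbar q) \<or>
         p \<in> frontier {q. Hbar q \<le> Hbar p} \<inter> frontier (closed_convex_hull {q. Hbar q \<le> Hbar p})}"

text \<open>
  Solutions of \<open>u\<^sub>t + G (D u) x = 0\<close> on \<open>\<real>\<^sup>d \<times> (0,\<infinity>)\<close> with \<open>u = u0\<close> at time \<open>0\<close>, in the class
  of functions bounded and uniformly continuous on \<open>\<real>\<^sup>d \<times> [0,T)\<close> for each \<open>T\<close>. The unknown is a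
  total function of \<open>(x, t)\<close>; its values for \<open>t < 0\<close> are irrelevant.
\<close>

definition cauchy_solution ::
    "(real ^ 'd \<Rightarrow> real ^ 'd \<Rightarrow> real) \<Rightarrow> (real ^ 'd \<Rightarrow> real) \<Rightarrow> ((real ^ 'd) \<times> real \<Rightarrow> real) \<Rightarrow> bool"
  where
  "cauchy_solution G u0 u \<longleftrightarrow>
     viscosity_solution (UNIV \<times> {0<..}) (\<lambda>(x, t) r (q, a). a + G q x) u \<and>
     (\<forall>x. u (x, 0) = u0 x) \<and>
     (\<forall>T>0. bounded (u ` (UNIV \<times> {0..<T})) \<and> uniformly_continuous_on (UNIV \<times> {0..<T}) u)"

end

theory Submission
  imports Defs
begin

text \<open>
  The expansion \<open>u\<^sup>\<epsilon>(x, t) \<approx> \<phi>(x, t) + \<epsilon> w(x / \<epsilon>)\<close> suggests that the corrector \<open>w = v p \<epsilon> \<omega>\<close> absorbs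
  the oscillation of \<open>H\<close> around the slope \<open>p = D\<phi>\<close>: its equation gives
  \<open>H (p + D w) y = - \<epsilon> w y\<close>, and on balls \<open>\<bar>y\<bar> < R / \<epsilon>\<close> the right-hand side converges uniformly to
  \<open>Hbar p\<close>. All slopes being homogenizing, such a corrector is at hand for each \<open>p\<close>. This is the
  perturbed test function method; since \<open>w\<close> is only Lipschitz, the perturbation is carried
  out by doubling the space variable (\<open>perturbed_test_function\<close>).

  The proof applies it directly to the maximum points of
  \<open>u\<^sup>\<epsilon> z - ubar z' - \<bar>z - z'\<bar>\<^sup>2 / (2 \<alpha>)\<close> minus penalties (\<open>solution_eventually_below_limit\<close>). If \<open>u\<^sup>\<epsilon>\<close> exceeds
  \<open>ubar\<close> by a fixed amount along some \<open>\<epsilon>\<^sub>n \<rightarrow> 0\<close>, these points converge along a subsequence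
  and determine a slope \<open>(p, a)\<close>. The supersolution \<open>ubar\<close> satisfies \<open>a + Hbar p \<ge> 0\<close> in the limit,
  because \<open>ubar\<close> is the same function for all \<open>\<epsilon>\<close>; the subsolution \<open>u\<^sup>\<epsilon>\<close>, tested at a single small
  \<open>\<epsilon>\<^sub>n\<close> with the corrector of slope exactly \<open>p\<close>, satisfies \<open>a + Hbar p < 0\<close>, since the penalty in
  time contributes a definite positive amount. Taking the corrector at the slope seen by \<open>ubar\<close>
  puts the whole gradient error of the penalties into \<open>H\<close>, which is Lipschitz there.

  That the maximum points stay away from \<open>t = 0\<close> follows from cones with apex on the initial
  datum, which are barriers uniform in \<open>\<epsilon>\<close> (\<open>cone_barrier\<close>).

  The argument bounds \<open>u\<^sup>\<epsilon>\<close> from above. The lower bound is the same statement for \<open>- u\<^sup>\<epsilon>\<close>,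
  \<open>- ubar\<close> and the Hamiltonian \<open>- H (- q)\<close>. Reflection destroys coercivity, so
  the upper bound is proved in the locale \<open>one_sided_homogenization\<close>, whose condition on the
  Hamiltonian is a weaker consequence of coercivity that survives the reflection.
\<close>

section \<open>Maximum points and viscosity inequalities\<close>

lemma attains_sup_if_bounded_superlevel:
  fixes f :: "'a::heine_borel \<Rightarrow> real"
  assumes "closed S" and "continuous_on S f" and "a \<in> S"
    and "bounded {x \<in> S. f a \<le> f x}"
  obtains b where "b \<in> S" and "\<And>x. x \<in> S \<Longrightarrow> f x \<le> f b"
proof -
  let ?K = "{x \<in> S. f a \<le> f x}"
  have "?K = S \<inter> f -` {f a..}" by auto
  then have "closed ?K"
    using continuous_closed_preimage[OF assms(2,1) closed_atLeast] by simp
  with assms(4) have K: "compact ?K" by (simp add: compact_eq_bounded_closed)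
  have "continuous_on ?K f" by (rule continuous_on_subset[OF assms(2)]) auto
  from continuous_attains_sup[OF K _ this] assms(3)
  obtain b where b: "b \<in> ?K" "\<And>x. x \<in> ?K \<Longrightarrow> f x \<le> f b" by auto
  have "f x \<le> f b" if "x \<in> S" for x
    using b that by (cases "f a \<le> f x") (auto intro: order_trans)
  with b(1) that show thesis by blast
qed

lemma viscosity_subsolution_at_local_max:
  assumes "viscosity_subsolution U F u"
    and "\<And>y. y \<in> U \<Longrightarrow> GDERIV \<phi> y :> D\<phi> y" and "continuous_on U D\<phi>"
    and "x \<in> U" and "e > 0"
    and "\<And>y. y \<in> U \<Longrightarrow> dist y x < e \<Longrightarrow> u y - \<phi> y \<le> u x - \<phi> x"
  shows "F x (u x) (D\<phi> x) \<le> 0"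
proof -
  have "\<forall>\<^sub>F y in at x within U. u y - \<phi> y \<le> u x - \<phi> x"
    unfolding eventually_at using assms(5,6) by blast
  with assms(1-4) show ?thesis unfolding viscosity_subsolution_def by blast
qed

lemma viscosity_supersolution_at_local_min:
  assumes "viscosity_supersolution U F u"
    and "\<And>y. y \<in> U \<Longrightarrow> GDERIV \<phi> y :> D\<phi> y" and "continuous_on U D\<phi>"
    and "x \<in> U" and "e > 0"
    and "\<And>y. y \<in> U \<Longrightarrow> dist y x < e \<Longrightarrow> u x - \<phi> x \<le> u y - \<phi> y"
  shows "0 \<le> F x (u x) (D\<phi> x)"
proof -
  have "\<forall>\<^sub>F y in at x within U. u x - \<phi> x \<le> u y - \<phi> y"
    unfolding eventually_at using assms(5,6) by blast
  with assms(1-4) show ?thesis unfolding viscosity_supersolution_def by blast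
qed

lemma viscosity_subsolution_uminus:
  assumes "viscosity_supersolution U F u"
    and "\<And>x r q. F' x r q = - F x (- r) (- q)"
  shows "viscosity_subsolution U F' (\<lambda>x. - u x)"
  unfolding viscosity_subsolution_def
proof (intro conjI allI impI ballI)
  fix x a assume "x \<in> U" and "- u x < a"
  then have "\<forall>\<^sub>F y in at x within U. - a < u y"
    using assms(1) unfolding viscosity_supersolution_def by (metis minus_less_iff)
  then show "\<forall>\<^sub>F y in at x within U. - u y < a" by (rule eventually_mono) simp
next
  fix \<phi> :: "'a \<Rightarrow> real" and D\<phi> x
  assume \<phi>: "(\<forall>y\<in>U. GDERIV \<phi> y :> D\<phi> y) \<and> continuous_on U D\<phi>" and x: "x \<in> U"
    and "\<forall>\<^sub>F y in at x within U. - u y - \<phi> y \<le> - u x - \<phi> x"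
  then have ev: "\<forall>\<^sub>F y in at x within U. u x - (- \<phi> x) \<le> u y - (- \<phi> y)"
    by (elim eventually_mono) simp
  have "(\<forall>y\<in>U. GDERIV (\<lambda>y. - \<phi> y) y :> - D\<phi> y) \<and> continuous_on U (\<lambda>y. - D\<phi> y)"
    using \<phi> by (auto intro!: GDERIV_minus continuous_on_minus)
  with assms(1)[unfolded viscosity_supersolution_def, THEN conjunct2, rule_format,
      of "\<lambda>y. - \<phi> y" "\<lambda>y. - D\<phi> y" x] x ev
  have "0 \<le> F x (u x) (- D\<phi> x)" by blast
  then show "F' x (- u x) (D\<phi> x) \<le> 0" by (simp add: assms(2))
qed

lemma viscosity_supersolution_uminus:
  assumes "viscosity_subsolution U F u"
    and "\<And>x r q. F' x r q = - F x (- r) (- q)"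
  shows "viscosity_supersolution U F' (\<lambda>x. - u x)"
  unfolding viscosity_supersolution_def
proof (intro conjI allI impI ballI)
  fix x a assume "x \<in> U" and "a < - u x"
  then have "\<forall>\<^sub>F y in at x within U. u y < - a"
    using assms(1) unfolding viscosity_subsolution_def by (metis less_minus_iff)
  then show "\<forall>\<^sub>F y in at x within U. a < - u y" by (rule eventually_mono) simp
next
  fix \<phi> :: "'a \<Rightarrow> real" and D\<phi> x
  assume \<phi>: "(\<forall>y\<in>U. GDERIV \<phi> y :> D\<phi> y) \<and> continuous_on U D\<phi>" and x: "x \<in> U"
    and "\<forall>\<^sub>F y in at x within U. - u x - \<phi> x \<le> - u y - \<phi> y"
  then have ev: "\<forall>\<^sub>F y in at x within U. u y - (- \<phi> y) \<le> u x - (- \<phi> x)"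
    by (elim eventually_mono) simp
  have "(\<forall>y\<in>U. GDERIV (\<lambda>y. - \<phi> y) y :> - D\<phi> y) \<and> continuous_on U (\<lambda>y. - D\<phi> y)"
    using \<phi> by (auto intro!: GDERIV_minus continuous_on_minus)
  with assms(1)[unfolded viscosity_subsolution_def, THEN conjunct2, rule_format,
      of "\<lambda>y. - \<phi> y" "\<lambda>y. - D\<phi> y" x] x ev
  have "F x (u x) (- D\<phi> x) \<le> 0" by blast
  then show "0 \<le> F' x (- u x) (D\<phi> x)" by (simp add: assms(2))
qed

section \<open>Smooth penalties\<close>

text \<open>
  The Japanese bracket: a smooth cone, coercive like the norm but with gradient of
  length at most 1 everywhere. Small multiples of it confine maximum points to bounded sets at the
  price of a small change of slope.
\<close>

definition jbracket :: "'a::real_inner \<Rightarrow> real" where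
  "jbracket x = sqrt (1 + x \<bullet> x)"

definition jgrad :: "'a::real_inner \<Rightarrow> 'a" where
  "jgrad x = x /\<^sub>R jbracket x"

lemma jbracket_ge_1: "1 \<le> jbracket x"
  by (simp add: jbracket_def)

lemma norm_le_jbracket: "norm x \<le> jbracket x"
  by (simp add: jbracket_def norm_eq_sqrt_inner)

lemma norm_jgrad_le_1: "norm (jgrad x) \<le> 1"
  using norm_le_jbracket[of x] jbracket_ge_1[of x]
  by (simp add: jgrad_def divide_simps)

lemma has_derivative_jbracket [derivative_intros]:
  assumes "(g has_derivative g') (at x)"
  shows "((\<lambda>x. jbracket (g x)) has_derivative (\<lambda>h. g' h \<bullet> jgrad (g x))) (at x)"
proof -
  have "1 + g x \<bullet> g x > 0" by (simp add: add_pos_nonneg)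
  with assms show ?thesis
    unfolding jbracket_def jgrad_def
    by (auto intro!: derivative_eq_intros simp: divide_simps inner_commute)
qed

lemma continuous_on_jbracket [continuous_intros]:
  "continuous_on S f \<Longrightarrow> continuous_on S (\<lambda>x. jbracket (f x))"
  unfolding jbracket_def by (intro continuous_intros)

lemma continuous_on_jgrad [continuous_intros]:
  "continuous_on S f \<Longrightarrow> continuous_on S (\<lambda>x. jgrad (f x))"
proof -
  assume f: "continuous_on S f"
  have "\<forall>x\<in>S. jbracket (f x) \<noteq> 0" by (metis jbracket_ge_1 not_one_le_zero)
  with f show ?thesis unfolding jgrad_def by (intro continuous_intros)
qed

lemma has_derivative_norm_square:
  fixes g :: "'a::real_normed_vector \<Rightarrow> 'b::real_inner"
  assumes "(g has_derivative g') (at x)"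
  shows "((\<lambda>x. (norm (g x))\<^sup>2) has_derivative (\<lambda>h. 2 * (g' h \<bullet> g x))) (at x)"
  unfolding power2_norm_eq_inner
  using has_derivative_inner[OF assms assms] by (simp add: inner_commute)

lemma has_derivative_quadratic_penalty:
  fixes g :: "'a::real_normed_vector \<Rightarrow> 'b::real_inner"
  assumes "(g has_derivative g') (at x)"
  shows "((\<lambda>x. (norm (g x))\<^sup>2 / (2 * c)) has_derivative (\<lambda>h. g' h \<bullet> (g x /\<^sub>R c))) (at x)"
  using has_derivative_mult_right[OF has_derivative_norm_square[OF assms], of "1 / (2 * c)"]
  by (simp add: divide_simps)

lemma norm_fst_le_norm: "norm (fst z) \<le> norm z" and norm_snd_le_norm: "norm (snd z) \<le> norm z"
  using dist_fst_le[of z 0] dist_snd_le[of z 0] by simp_all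

text \<open>
  Supplies the terminal penalty \<open>A exp (l (t - T))\<close>: it is at least \<open>A\<close> from time \<open>T\<close> on, which
  keeps maximum points before \<open>T\<close>, and less than \<open>\<theta>\<close> up to time \<open>T - 1\<close>. Unlike the customary
  \<open>1 / (T - t)\<close> it is smooth for all times, as a test function on \<open>t > 0\<close> has to be.
\<close>

lemma small_exp_penalty:
  fixes A \<theta> :: real
  assumes "A > 0" and "\<theta> > 0"
  obtains l where "l > 0" and "A * exp (- l) < \<theta>"
proof
  show "A / \<theta> > 0" using assms by simp
  have "A / \<theta> < exp (A / \<theta>)" using exp_ge_add_one_self[of "A / \<theta>"] by linarith
  then show "A * exp (- (A / \<theta>)) < \<theta>"
    using assms by (simp add: exp_minus divide_simps mult.commute)
qed

section \<open>Barriers\<close>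

text \<open>
  The cone with slope \<open>K\<close> moving up at speed \<open>C\<close> is a classical supersolution as soon as \<open>- C\<close> bounds
  the Hamiltonian from below on slopes up to \<open>K\<close>. Being smooth, it serves as a test function
  itself, and the penalty in time makes its inequality strict. The barrier depends on the Hamiltonian
  only through this bound, hence not on how fast it oscillates in space.
\<close>

lemma cone_barrier:
  fixes g :: "'a::euclidean_space \<Rightarrow> 'a \<Rightarrow> real" and u :: "'a \<times> real \<Rightarrow> real"
  assumes sub: "viscosity_subsolution (UNIV \<times> {0<..}) (\<lambda>(x, t) r (q, a). a + g q x) u"
    and cont: "\<And>T. continuous_on (UNIV \<times> {0..T}) u"
    and bdd: "\<And>T. \<exists>M. \<forall>x. \<forall>t\<in>{0..T}. u (x, t) \<le> M"
    and K: "K > 0" and C: "\<And>q x. norm q \<le> K \<Longrightarrow> - C \<le> g q x"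
    and init: "\<And>y. u (y, 0) \<le> a + K * (jbracket (y - x0) - 1)"
    and t: "t \<ge> 0"
  shows "u (x, t) \<le> a + K * (jbracket (x - x0) - 1) + C * t"
proof (rule ccontr)
  assume contra: "\<not> ?thesis"
  define T where "T = t + 1"
  define \<phi> where "\<phi> z = a + K * (jbracket (fst z - x0) - 1) + C * snd z" for z :: "'a \<times> real"
  define \<theta> where "\<theta> = u (x, t) - \<phi> (x, t)"
  have \<theta>: "\<theta> > 0" using contra by (simp add: \<theta>_def \<phi>_def)
  obtain M where M: "\<And>y s. 0 \<le> s \<Longrightarrow> s \<le> T \<Longrightarrow> u (y, s) \<le> M"
    using bdd[of T] by (meson atLeastAtMost_iff)
  define A where "A = \<bar>M\<bar> + \<bar>a\<bar> + \<bar>C\<bar> * T + 1"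
  have T: "T > 0" using t by (simp add: T_def)
  have A: "A > 0" using T by (simp add: A_def add_nonneg_pos)
  obtain l where l: "l > 0" "A * exp (- l) < \<theta>" using small_exp_penalty[OF A \<theta>] .
  define P where "P s = A * exp (l * (s - T))" for s
  have Ppos: "P s > 0" for s using A by (simp add: P_def)
  define S where "S = (UNIV :: 'a set) \<times> {0..T}"
  define f where "f z = u z - (\<phi> z + P (snd z))" for z
  have uA: "u (y, s) - \<phi> (y, s) \<le> A - 1 - K * (jbracket (y - x0) - 1)"
    if "0 \<le> s" "s \<le> T" for y s
  proof -
    have "- C * s \<le> \<bar>C\<bar> * T"
      using that by (intro mult_mono) auto
    with M[OF that, of y] show ?thesis by (simp add: \<phi>_def A_def)
  qed
  have f0: "f (x, t) > 0" using l(2) by (simp add: f_def \<theta>_def P_def T_def)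
  have "closed S" by (auto simp: S_def intro!: closed_Times)
  moreover have "continuous_on S f"
    unfolding f_def \<phi>_def P_def S_def using cont[of T]
    by (auto intro!: continuous_intros)
  moreover have xt: "(x, t) \<in> S" using t by (simp add: S_def T_def)
  moreover have "bounded {z \<in> S. f (x, t) \<le> f z}"
  proof (rule bounded_subset)
    show "bounded (cball x0 (A / K + 1) \<times> {0..T})"
      by (intro bounded_Times) auto
    show "{z \<in> S. f (x, t) \<le> f z} \<subseteq> cball x0 (A / K + 1) \<times> {0..T}"
    proof clarsimp
      fix y s assume ys: "(y, s) \<in> S" "f (x, t) \<le> f (y, s)"
      then have s: "0 \<le> s" "s \<le> T" by (auto simp: S_def)
      have "0 < A - K * (jbracket (y - x0) - 1)"
        using uA[OF s, of y] Ppos[of s] ys(2) f0 by (simp add: f_def)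
      then have "jbracket (y - x0) - 1 < A / K" using K by (simp add: field_simps)
      then show "dist x0 y \<le> A / K + 1 \<and> 0 \<le> s \<and> s \<le> T"
        using norm_le_jbracket[of "y - x0"] s by (simp add: dist_norm norm_minus_commute)
    qed
  qed
  ultimately obtain z where z: "z \<in> S" "\<And>z'. z' \<in> S \<Longrightarrow> f z' \<le> f z"
    using attains_sup_if_bounded_superlevel by blast
  obtain y s where ys: "z = (y, s)" by fastforce
  have s: "0 \<le> s" "s \<le> T" using z(1) by (auto simp: S_def ys)
  have fz: "f (y, s) > 0" using z(2)[OF xt] f0 ys by simp
  have "s \<noteq> 0" using fz init[of y] Ppos[of 0] by (auto simp: f_def \<phi>_def)
  moreover have "s \<noteq> T"
  proof
    assume "s = T"
    moreover have "0 \<le> K * (jbracket (y - x0) - 1)" using K jbracket_ge_1[of "y - x0"] by simp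
    ultimately show False using fz uA[OF s, of y] by (simp add: f_def P_def)
  qed
  ultimately have s: "0 < s" "s < T" using s by auto
  define D where "D z = (K *\<^sub>R jgrad (fst z - x0), C + l * P (snd z))" for z :: "'a \<times> real"
  have "(\<lambda>(x, t) r (q, a). a + g q x) z (u z) (D z) \<le> 0"
  proof (rule viscosity_subsolution_at_local_max[OF sub])
    show "z \<in> UNIV \<times> {0<..}" using s by (simp add: ys)
    show "min s (T - s) > 0" using s by simp
    show "GDERIV (\<lambda>z. \<phi> z + P (snd z)) z' :> D z'" for z'
      unfolding gderiv_def \<phi>_def P_def D_def
      by (auto intro!: derivative_eq_intros simp: inner_prod_def algebra_simps)
    show "continuous_on (UNIV \<times> {0<..}) D"
      unfolding D_def P_def by (intro continuous_intros)
    fix z' :: "'a \<times> real" assume "z' \<in> UNIV \<times> {0<..}" "dist z' z < min s (T - s)"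
    moreover have "dist (snd z') (snd z) \<le> dist z' z" by (rule dist_snd_le)
    ultimately have "z' \<in> S"
      by (cases z') (auto simp: S_def ys dist_real_def)
    from z(2)[OF this] show "u z' - (\<phi> z' + P (snd z')) \<le> u z - (\<phi> z + P (snd z))"
      by (simp add: f_def)
  qed
  then have "C + l * P s + g (K *\<^sub>R jgrad (y - x0)) y \<le> 0" by (simp add: ys D_def)
  moreover have "norm (K *\<^sub>R jgrad (y - x0)) \<le> K"
    using K norm_jgrad_le_1[of "y - x0"] by (simp add: mult_left_le)
  from C[OF this, of y] have "- C \<le> g (K *\<^sub>R jgrad (y - x0)) y" .
  moreover have "l * P s > 0" using l Ppos by simp
  ultimately show False by linarith
qed

text \<open>
  Near \<open>x\<close> the excess \<open>e\<close> suffices by uniform continuity; away from \<open>x\<close> the cone exceeds the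
  oscillation of the bounded function once \<open>K\<close> is large, uniformly in \<open>x\<close>.
\<close>

lemma cone_above_uniformly_continuous:
  fixes f :: "'a::real_inner \<Rightarrow> real"
  assumes "bounded (range f)" and "uniformly_continuous_on UNIV f" and "e > 0"
  obtains K where "K > 0" and "\<And>x y. f y \<le> f x + e + K * (jbracket (y - x) - 1)"
proof -
  obtain M where M: "\<And>x. \<bar>f x\<bar> \<le> M" using assms(1) by (auto simp: bounded_iff)
  obtain d where d: "d > 0" "\<And>x y. dist y x < d \<Longrightarrow> dist (f y) (f x) < e"
    using uniformly_continuous_onE[OF assms(2,3)] by (metis UNIV_I)
  define c where "c = sqrt (1 + d\<^sup>2) - 1"
  have c: "c > 0" using d(1) by (simp add: c_def)
  have M0: "M \<ge> 0" using M[of 0] by linarith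
  define K where "K = (2 * M + 1) / c"
  have K: "K > 0" using M0 c by (simp add: K_def)
  have "f y \<le> f x + e + K * (jbracket (y - x) - 1)" for x y
  proof (cases "dist y x < d")
    case True
    have "f y < f x + e" using d(2)[OF True] by (simp add: dist_real_def)
    moreover have "0 \<le> K * (jbracket (y - x) - 1)" using K jbracket_ge_1[of "y - x"] by simp
    ultimately show ?thesis by linarith
  next
    case False
    then have "d\<^sup>2 \<le> (norm (y - x))\<^sup>2" using d(1) by (simp add: dist_norm power_mono)
    then have "c \<le> jbracket (y - x) - 1" by (simp add: c_def jbracket_def dot_square_norm)
    then have "K * c \<le> K * (jbracket (y - x) - 1)" using K by simp
    moreover have "K * c = 2 * M + 1" using c by (simp add: K_def)
    ultimately show ?thesis using M[of x] M[of y] assms(3) by linarith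
  qed
  with K that show thesis by blast
qed

section \<open>The perturbed test function\<close>

text \<open>
  Formally \<open>u - \<phi> - \<epsilon> w (x / \<epsilon>)\<close> has an interior maximum, where \<open>D u = D\<phi> + D w\<close>; there
  \<open>h (D\<phi> + D w) \<le> - \<partial>\<^sub>t\<phi>\<close> from the equation of \<open>u\<close> and \<open>h (p + D w) \<ge> - \<epsilon> w \<approx> c\<close> from that of \<open>w\<close>,
  and the Lipschitz bound compares the two since \<open>D\<phi> \<approx> p\<close>. For nonsmooth \<open>w\<close> the two space
  variables are doubled, and the common value \<open>q\<close> of \<open>D w\<close> comes from the
  doubling penalty. Nothing bounds \<open>q\<close> in advance; therefore the Lipschitz bound is formulated in
  terms of values of \<open>h\<close>, which the two equations control. The quadratic term in \<open>max\<close> beats the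
  oscillation \<open>2 * s\<close> of the corrector on the boundary of the ball, so that the maximum is interior.
\<close>

lemma perturbed_test_function:
  fixes h :: "'a::euclidean_space \<Rightarrow> 'a \<Rightarrow> real" and u :: "'a \<times> real \<Rightarrow> real"
  assumes sub: "viscosity_subsolution (UNIV \<times> {0<..})
      (\<lambda>(x, t) r (q, a). a + h q (x /\<^sub>R \<epsilon>)) u"
    and super: "viscosity_supersolution UNIV (\<lambda>y r q. \<epsilon> * r + h (p + q) y) w"
    and eps: "\<epsilon> > 0" and w_cont: "continuous_on UNIV w"
    and lip: "\<And>q1 q2 y1 y2. h q1 y1 \<le> B \<Longrightarrow> - B \<le> h q2 y2 \<Longrightarrow> norm (q1 - q2) \<le> 1
      \<Longrightarrow> h q2 y2 - h q1 y1 \<le> C * (norm (q1 - q2) + norm (y1 - y2))"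
    and C: "C \<ge> 0"
    and z0: "0 < r" "r < snd z0" and u_cont: "continuous_on (cball z0 r) u"
    and \<phi>: "\<And>z. GDERIV \<phi> z :> D\<phi> z" and D\<phi>_cont: "continuous_on UNIV D\<phi>"
    and max: "\<And>z. z \<in> cball z0 r \<Longrightarrow> u z - \<phi> z + (norm (z - z0))\<^sup>2 \<le> u z0 - \<phi> z0"
    and D\<phi>: "\<And>z. z \<in> cball z0 r \<Longrightarrow> norm (fst (D\<phi> z) - p) \<le> \<kappa>"
            "\<And>z. z \<in> cball z0 r \<Longrightarrow> a0 \<le> snd (D\<phi> z)"
    and \<kappa>: "\<kappa> \<le> 1"
    and w: "\<And>y. norm (\<epsilon> *\<^sub>R y - fst z0) \<le> 2 * r \<Longrightarrow> \<bar>c + \<epsilon> * w y\<bar> \<le> s"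
    and s: "2 * s < r\<^sup>2" and B: "- a0 \<le> B" "s - c \<le> B"
  shows "a0 + c \<le> C * \<kappa> + s"
proof (rule field_le_epsilon)
  fix e :: real assume e: "e > 0"
  obtain x0 t0 where xt0: "z0 = (x0, t0)" by fastforce
  have s0: "s \<ge> 0" using w[of "x0 /\<^sub>R \<epsilon>"] z0 eps by (simp add: xt0)
  \<comment> \<open>\<open>\<rho>\<close> bounds the distance between the two copies of the space variable.\<close>
  define \<rho> where "\<rho> = min (r / 2) (e * \<epsilon> / (C + 1))"
  have \<rho>: "\<rho> > 0" using z0 e eps C by (simp add: \<rho>_def)
  have C\<rho>: "C * (\<rho> / \<epsilon>) \<le> e"
  proof -
    have "C * \<rho> \<le> C * (e * \<epsilon> / (C + 1))"
      unfolding \<rho>_def using C by (intro mult_left_mono) auto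
    also have "\<dots> = e * \<epsilon> * (C / (C + 1))" by simp
    also have "\<dots> \<le> e * \<epsilon> * 1" using C e eps by (intro mult_left_mono) auto
    finally show ?thesis using eps by (simp add: field_simps)
  qed
  \<comment> \<open>The doubling parameter is so small that a penalty of at most \<open>2 * s\<close> forces distance \<open>\<rho>\<close>.\<close>
  define \<gamma> where "\<gamma> = \<rho>\<^sup>2 / (4 * s + 1)"
  have \<gamma>: "\<gamma> > 0" using \<rho> s0 by (simp add: \<gamma>_def)
  have \<gamma>s: "4 * s * \<gamma> \<le> \<rho>\<^sup>2"
  proof -
    have "4 * s * \<gamma> = \<rho>\<^sup>2 * (4 * s / (4 * s + 1))" by (simp add: \<gamma>_def)
    also have "\<dots> \<le> \<rho>\<^sup>2 * 1" using s0 by (intro mult_left_mono) auto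
    finally show ?thesis by simp
  qed
  define S where "S = cball z0 r \<times> cball (x0 /\<^sub>R \<epsilon>) (2 * r / \<epsilon>)"
  define f where "f Z = u (fst Z) - \<phi> (fst Z) - \<epsilon> * w (snd Z)
      - (norm (fst (fst Z) - \<epsilon> *\<^sub>R snd Z))\<^sup>2 / (2 * \<gamma>)" for Z
  have \<phi>_cont: "continuous_on A \<phi>" for A
    using \<phi> by (intro continuous_at_imp_continuous_on ballI) (metis gderiv_def has_derivative_continuous)
  have "compact S" unfolding S_def by (intro compact_Times compact_cball)
  moreover have Z0: "(z0, x0 /\<^sub>R \<epsilon>) \<in> S" using z0 eps by (simp add: S_def)
  moreover have "continuous_on S f"
  proof -
    have "continuous_on S (\<lambda>Z. u (fst Z))"
      by (rule continuous_on_compose2[OF u_cont continuous_on_fst]) (auto simp: S_def intro: continuous_on_id)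
    moreover have "continuous_on S (\<lambda>Z. \<phi> (fst Z))"
      by (rule continuous_on_compose2[OF \<phi>_cont continuous_on_fst]) (auto intro: continuous_on_id)
    moreover have "continuous_on S (\<lambda>Z. w (snd Z))"
      by (rule continuous_on_compose2[OF w_cont continuous_on_snd]) (auto intro: continuous_on_id)
    ultimately show ?thesis unfolding f_def using \<gamma> by (auto intro!: continuous_intros)
  qed
  ultimately obtain Z where Z: "Z \<in> S" "\<And>Z'. Z' \<in> S \<Longrightarrow> f Z' \<le> f Z"
    using continuous_attains_sup[of S f] by blast
  obtain x t y where xty: "Z = ((x, t), y)" by (metis surj_pair)
  define z where "z = (x, t)"
  have zS: "z \<in> cball z0 r" using Z(1) by (simp add: S_def xty z_def)
  have cball_iff: "norm (\<epsilon> *\<^sub>R y' - x0) \<le> 2 * r \<longleftrightarrow> y' \<in> cball (x0 /\<^sub>R \<epsilon>) (2 * r / \<epsilon>)" for y'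
  proof -
    have "\<epsilon> *\<^sub>R y' - x0 = \<epsilon> *\<^sub>R (y' - x0 /\<^sub>R \<epsilon>)" using eps by (simp add: algebra_simps)
    then have "norm (\<epsilon> *\<^sub>R y' - x0) = \<epsilon> * dist (x0 /\<^sub>R \<epsilon>) y'"
      using eps by (simp add: dist_norm norm_minus_commute)
    then show ?thesis using eps by (simp add: field_simps)
  qed
  have wy: "\<bar>c + \<epsilon> * w y\<bar> \<le> s"
    using w[of y] Z(1) cball_iff[of y] by (simp add: xty S_def xt0)
  have "\<bar>c + \<epsilon> * w (x0 /\<^sub>R \<epsilon>)\<bar> \<le> s" using w[of "x0 /\<^sub>R \<epsilon>"] z0 eps by (simp add: xt0)
  \<comment> \<open>Comparing the maximum with the value at the centre locates the maximum point.\<close>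
  with wy max[OF zS] Z(2)[OF Z0]
  have gap: "(norm (z - z0))\<^sup>2 + (norm (x - \<epsilon> *\<^sub>R y))\<^sup>2 / (2 * \<gamma>) \<le> 2 * s"
    using eps by (simp add: f_def xty z_def xt0 abs_le_iff)
  have "0 \<le> (norm (x - \<epsilon> *\<^sub>R y))\<^sup>2 / (2 * \<gamma>)" using \<gamma> by simp
  with gap s have "(norm (z - z0))\<^sup>2 < r\<^sup>2" by linarith
  then have zr: "norm (z - z0) < r" using z0 power2_less_imp_less by fastforce
  have "(norm (x - \<epsilon> *\<^sub>R y))\<^sup>2 / (2 * \<gamma>) \<le> 2 * s"
    using gap zero_le_power2[of "norm (z - z0)"] by linarith
  then have "(norm (x - \<epsilon> *\<^sub>R y))\<^sup>2 \<le> 4 * s * \<gamma>" using \<gamma> by (simp add: field_simps)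
  with \<gamma>s have "(norm (x - \<epsilon> *\<^sub>R y))\<^sup>2 \<le> \<rho>\<^sup>2" by linarith
  then have xy: "norm (x - \<epsilon> *\<^sub>R y) \<le> \<rho>" using \<rho> power2_le_imp_le by fastforce
  \<comment> \<open>The slope that the doubling penalty transmits from \<open>w\<close> to \<open>u\<close>.\<close>
  define q where "q = (x - \<epsilon> *\<^sub>R y) /\<^sub>R \<gamma>"
  define Q where "Q = fst (D\<phi> z)"
  define a where "a = snd (D\<phi> z)"
  have t: "t > 0"
  proof -
    have "\<bar>t - t0\<bar> < r"
      using zr dist_snd_le[of z z0] by (simp add: xt0 z_def dist_norm)
    then show ?thesis using z0 by (simp add: xt0)
  qed
  have "(\<lambda>(x, t) r (q, a). a + h q (x /\<^sub>R \<epsilon>)) z (u z) (D\<phi> z + (q, 0)) \<le> 0"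
  proof -
    define \<psi> where "\<psi> z' = \<phi> z' + (norm (fst z' - \<epsilon> *\<^sub>R y))\<^sup>2 / (2 * \<gamma>)" for z' :: "'a \<times> real"
    define D where "D z' = D\<phi> z' + ((fst z' - \<epsilon> *\<^sub>R y) /\<^sub>R \<gamma>, 0)" for z' :: "'a \<times> real"
    have "(\<lambda>(x, t) r (q, a). a + h q (x /\<^sub>R \<epsilon>)) z (u z) (D z) \<le> 0"
    proof (rule viscosity_subsolution_at_local_max[OF sub])
      show "z \<in> UNIV \<times> {0<..}" using t by (simp add: z_def)
      show "r - norm (z - z0) > 0" using zr by simp
      show "continuous_on (UNIV \<times> {0<..}) D"
        unfolding D_def using continuous_on_subset[OF D\<phi>_cont]
        by (auto intro!: continuous_intros)
      show "GDERIV \<psi> z' :> D z'" for z'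
      proof -
        have "((\<lambda>z'. (norm (fst z' - \<epsilon> *\<^sub>R y))\<^sup>2 / (2 * \<gamma>)) has_derivative
            (\<lambda>h. fst h \<bullet> ((fst z' - \<epsilon> *\<^sub>R y) /\<^sub>R \<gamma>))) (at z')"
          by (intro has_derivative_quadratic_penalty) (auto intro!: derivative_eq_intros)
        from has_derivative_add[OF \<phi>[of z', unfolded gderiv_def] this]
        show ?thesis by (simp only: gderiv_def \<psi>_def[abs_def] D_def inner_add_right inner_Pair_0)
      qed
      fix z' assume "dist z' z < r - norm (z - z0)"
      then have "dist z0 z' \<le> r"
        using dist_triangle2[of z0 z' z] by (simp add: dist_norm norm_minus_commute)
      then have "(z', y) \<in> S" using Z(1) by (simp add: S_def xty)
      from Z(2)[OF this] show "u z' - \<psi> z' \<le> u z - \<psi> z"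
        by (simp add: f_def \<psi>_def xty z_def)
    qed
    then show ?thesis by (simp add: D_def q_def z_def)
  qed
  then have h1: "a + h (Q + q) (x /\<^sub>R \<epsilon>) \<le> 0"
    by (simp add: a_def Q_def z_def case_prod_beta)
  have h2: "0 \<le> \<epsilon> * w y + h (p + q) y"
  proof -
    define \<psi> where "\<psi> y' = - (norm (x - \<epsilon> *\<^sub>R y'))\<^sup>2 / (2 * \<gamma> * \<epsilon>)" for y'
    define D where "D y' = (x - \<epsilon> *\<^sub>R y') /\<^sub>R \<gamma>" for y'
    have "0 \<le> (\<lambda>y r q. \<epsilon> * r + h (p + q) y) y (w y) (D y)"
    proof (rule viscosity_supersolution_at_local_min[OF super])
      show "r / (2 * \<epsilon>) > 0" using z0 eps by simp
      show "continuous_on UNIV D" unfolding D_def by (intro continuous_intros)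
      show "GDERIV \<psi> y' :> D y'" for y'
      proof -
        have "((\<lambda>y'. (norm (x - \<epsilon> *\<^sub>R y'))\<^sup>2 / (2 * (- \<gamma> * \<epsilon>))) has_derivative
            (\<lambda>h. (- \<epsilon> *\<^sub>R h) \<bullet> ((x - \<epsilon> *\<^sub>R y') /\<^sub>R (- \<gamma> * \<epsilon>)))) (at y')"
          by (intro has_derivative_quadratic_penalty) (auto intro!: derivative_eq_intros)
        moreover have "(- \<epsilon> *\<^sub>R h) \<bullet> ((x - \<epsilon> *\<^sub>R y') /\<^sub>R (- \<gamma> * \<epsilon>)) = h \<bullet> D y'" for h
          using eps \<gamma> unfolding D_def by (simp only: inner_scaleR_left inner_scaleR_right) simp
        moreover have "(norm (x - \<epsilon> *\<^sub>R y'))\<^sup>2 / (2 * (- \<gamma> * \<epsilon>)) = \<psi> y'" for y'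
          by (simp add: \<psi>_def mult.assoc)
        ultimately show ?thesis by (simp only: gderiv_def)
      qed
      fix y' assume "dist y' y < r / (2 * \<epsilon>)"
      then have "\<epsilon> * norm (y' - y) < r / 2" using eps by (simp add: dist_norm field_simps)
      then have "norm (\<epsilon> *\<^sub>R (y' - y)) < r / 2" using eps by (simp del: scaleR_diff_right)
      moreover have "\<rho> \<le> r / 2" unfolding \<rho>_def by (rule min.cobounded1)
      moreover have "norm (x - x0) < r"
        using zr dist_fst_le[of z z0] by (simp add: xt0 z_def dist_norm)
      ultimately have "norm (\<epsilon> *\<^sub>R (y' - y) - (x - \<epsilon> *\<^sub>R y) + (x - x0)) \<le> 2 * r"
        using xy norm_triangle_ineq[of "\<epsilon> *\<^sub>R (y' - y) - (x - \<epsilon> *\<^sub>R y)" "x - x0"]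
          norm_triangle_ineq4[of "\<epsilon> *\<^sub>R (y' - y)" "x - \<epsilon> *\<^sub>R y"] by linarith
      then have "norm (\<epsilon> *\<^sub>R y' - x0) \<le> 2 * r" by (simp add: algebra_simps)
      then have "(z, y') \<in> S" using zS cball_iff by (simp add: S_def)
      from Z(2)[OF this]
      have "\<epsilon> * w y + (norm (x - \<epsilon> *\<^sub>R y))\<^sup>2 / (2 * \<gamma>)
          \<le> \<epsilon> * w y' + (norm (x - \<epsilon> *\<^sub>R y'))\<^sup>2 / (2 * \<gamma>)"
        by (simp add: f_def xty z_def)
      then have "(\<epsilon> * w y + (norm (x - \<epsilon> *\<^sub>R y))\<^sup>2 / (2 * \<gamma>)) / \<epsilon>
          \<le> (\<epsilon> * w y' + (norm (x - \<epsilon> *\<^sub>R y'))\<^sup>2 / (2 * \<gamma>)) / \<epsilon>"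
        using eps by (intro divide_right_mono) auto
      then show "w y - \<psi> y \<le> w y' - \<psi> y'"
        using eps by (simp add: \<psi>_def add_divide_distrib)
    qed simp
    then show ?thesis by (simp add: D_def q_def)
  qed
  have a: "a0 \<le> a" using D\<phi>(2)[OF zS] by (simp add: a_def)
  have \<epsilon>w: "\<epsilon> * w y \<le> s - c" using wy by linarith
  have Qp: "norm ((Q + q) - (p + q)) \<le> \<kappa>" using D\<phi>(1)[OF zS] by (simp add: Q_def)
  have "h (Q + q) (x /\<^sub>R \<epsilon>) \<le> B" using h1 a B by linarith
  moreover have "- B \<le> h (p + q) y" using h2 \<epsilon>w B by linarith
  moreover have "norm ((Q + q) - (p + q)) \<le> 1" using Qp \<kappa> by linarith
  ultimately have "h (p + q) y - h (Q + q) (x /\<^sub>R \<epsilon>)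
      \<le> C * (norm ((Q + q) - (p + q)) + norm (x /\<^sub>R \<epsilon> - y))"
    by (rule lip)
  also have "\<dots> \<le> C * (\<kappa> + \<rho> / \<epsilon>)"
  proof -
    have "x /\<^sub>R \<epsilon> - y = (x - \<epsilon> *\<^sub>R y) /\<^sub>R \<epsilon>" using eps by (simp add: algebra_simps)
    then have "norm (x /\<^sub>R \<epsilon> - y) = norm (x - \<epsilon> *\<^sub>R y) / \<epsilon>"
      using eps by (simp only: norm_scaleR) (simp add: divide_inverse mult.commute)
    with xy eps have "norm (x /\<^sub>R \<epsilon> - y) \<le> \<rho> / \<epsilon>" by (simp add: divide_right_mono)
    with Qp C show ?thesis by (intro mult_left_mono) auto
  qed
  also have "\<dots> \<le> C * \<kappa> + e" using C\<rho> by (simp add: algebra_simps)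
  finally show "a0 + c \<le> C * \<kappa> + s + e" using h1 h2 a \<epsilon>w by linarith
qed

section \<open>The one-sided comparison\<close>

text \<open>
  The condition \<open>lip\<close> couples an upper bound of \<open>h\<close> at one slope with a lower bound at a nearby
  slope. If \<open>h\<close> is coercive, the upper bound confines both slopes to a ball, where \<open>h\<close> is
  Lipschitz; if \<open>- h\<close> is coercive, the lower bound does. So \<open>lip\<close> holds for \<open>h q y\<close> and for
  \<open>- h (- q) y\<close> alike.
\<close>

locale one_sided_homogenization =
  fixes h :: "'a::euclidean_space \<Rightarrow> 'a \<Rightarrow> real" and hbar :: "'a \<Rightarrow> real"
    and w :: "'a \<Rightarrow> real \<Rightarrow> 'a \<Rightarrow> real"
    and u0 :: "'a \<Rightarrow> real" and u :: "real \<Rightarrow> 'a \<times> real \<Rightarrow> real" and ubar :: "'a \<times> real \<Rightarrow> real"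
  assumes lip: "\<And>B. \<exists>C. \<forall>q1 q2 y1 y2. h q1 y1 \<le> B \<longrightarrow> - B \<le> h q2 y2 \<longrightarrow> norm (q1 - q2) \<le> 1
      \<longrightarrow> h q2 y2 - h q1 y1 \<le> C * (norm (q1 - q2) + norm (y1 - y2))"
    and lower: "\<And>K. \<exists>C. \<forall>q y. norm q \<le> K \<longrightarrow> - C \<le> h q y"
    and w_super: "\<And>p \<delta>. \<delta> > 0 \<Longrightarrow> viscosity_supersolution UNIV (\<lambda>y r q. \<delta> * r + h (p + q) y) (w p \<delta>)"
    and w_cont: "\<And>p \<delta>. \<delta> > 0 \<Longrightarrow> continuous_on UNIV (w p \<delta>)"
    and w_conv: "\<And>p R s. R > 0 \<Longrightarrow> s > 0 \<Longrightarrow>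
      \<forall>\<^sub>F \<delta> in at_right 0. \<forall>y. norm (\<delta> *\<^sub>R y) < R \<longrightarrow> \<bar>hbar p + \<delta> * w p \<delta> y\<bar> \<le> s"
    and u0_bdd: "bounded (range u0)" and u0_uc: "uniformly_continuous_on UNIV u0"
    and u_sub: "\<And>\<epsilon>. \<epsilon> > 0 \<Longrightarrow> viscosity_subsolution (UNIV \<times> {0<..})
      (\<lambda>(x, t) r (q, a). a + h q (x /\<^sub>R \<epsilon>)) (u \<epsilon>)"
    and u_cont: "\<And>\<epsilon> T. \<epsilon> > 0 \<Longrightarrow> continuous_on (UNIV \<times> {0..T}) (u \<epsilon>)"
    and u_bdd: "\<And>\<epsilon> T. \<epsilon> > 0 \<Longrightarrow> \<exists>M. \<forall>x. \<forall>t\<in>{0..T}. u \<epsilon> (x, t) \<le> M"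
    and u_init: "\<And>\<epsilon> x. \<epsilon> > 0 \<Longrightarrow> u \<epsilon> (x, 0) = u0 x"
    and ubar_super: "viscosity_supersolution (UNIV \<times> {0<..}) (\<lambda>(x, t) r (q, a). a + hbar q) ubar"
    and ubar_uc: "\<And>T. uniformly_continuous_on (UNIV \<times> {0..T}) ubar"
    and ubar_bdd: "\<And>T. \<exists>M. \<forall>x. \<forall>t\<in>{0..T}. - M \<le> ubar (x, t)"
    and ubar_init: "\<And>x. ubar (x, 0) = u0 x"
begin

lemma uniform_upper_bound:
  obtains M where "\<And>\<epsilon> x t. \<epsilon> > 0 \<Longrightarrow> 0 \<le> t \<Longrightarrow> t \<le> T \<Longrightarrow> u \<epsilon> (x, t) \<le> M"
proof -
  obtain N where N: "\<And>x. \<bar>u0 x\<bar> \<le> N" using u0_bdd by (auto simp: bounded_iff)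
  obtain C where C: "\<And>q y. norm q \<le> 1 \<Longrightarrow> - C \<le> h q y" using lower[of 1] by blast
  have "u \<epsilon> (x, t) \<le> N + \<bar>C\<bar> * T" if eps: "\<epsilon> > 0" and t: "0 \<le> t" "t \<le> T" for \<epsilon> x t
  proof -
    have "u \<epsilon> (x, t) \<le> N + 1 * (jbracket (x - x) - 1) + C * t"
    proof (rule cone_barrier[OF u_sub[OF eps] u_cont[OF eps] u_bdd[OF eps] _ _ _ t(1)])
      fix y show "u \<epsilon> (y, 0) \<le> N + 1 * (jbracket (y - x) - 1)"
        using N[of y] u_init[OF eps, of y] jbracket_ge_1[of "y - x"] by (simp add: abs_le_iff)
    qed (use C in auto)
    also have "\<dots> = N + C * t" by (simp add: jbracket_def)
    also have "\<dots> \<le> N + \<bar>C\<bar> * T" using t by (intro add_left_mono mult_mono) auto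
    finally show ?thesis .
  qed
  then show thesis by (rule that)
qed

text \<open>
  Cones with apex slightly above \<open>u0 x\<close> bound \<open>u \<epsilon> (x, t)\<close> by \<open>u0 x\<close> plus a modulus of \<open>t\<close> that does
  not depend on \<open>\<epsilon>\<close>; for \<open>ubar\<close> such a modulus is its uniform continuity.
\<close>

lemma uniform_initial_bound:
  assumes e: "e > 0"
  obtains t1 where "t1 > 0"
    and "\<And>\<epsilon> x t. \<epsilon> > 0 \<Longrightarrow> 0 \<le> t \<Longrightarrow> t \<le> t1 \<Longrightarrow> u \<epsilon> (x, t) \<le> ubar (x, t) + e"
proof -
  obtain K where K: "K > 0" "\<And>x y. u0 y \<le> u0 x + e / 3 + K * (jbracket (y - x) - 1)"
    using cone_above_uniformly_continuous[OF u0_bdd u0_uc, of "e / 3"] e by auto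
  obtain C where C: "\<And>q y. norm q \<le> K \<Longrightarrow> - C \<le> h q y" using lower[of K] by blast
  obtain d where d: "d > 0" "\<And>z z'. z \<in> UNIV \<times> {0..1} \<Longrightarrow> z' \<in> UNIV \<times> {0..1} \<Longrightarrow> dist z' z < d
      \<Longrightarrow> dist (ubar z') (ubar z) < e / 3"
    by (rule uniformly_continuous_onE[OF ubar_uc[of 1], of "e / 3"]) (use e in auto)
  define t1 where "t1 = Min {1, d / 2, e / (3 * (\<bar>C\<bar> + 1))}"
  have t1: "t1 > 0" "t1 \<le> 1" "t1 \<le> d / 2" "t1 \<le> e / (3 * (\<bar>C\<bar> + 1))"
    unfolding t1_def using d(1) e by (simp_all only: Min_le finite.intros insert_iff refl simp_thms)
      auto
  have "u \<epsilon> (x, t) \<le> ubar (x, t) + e" if eps: "\<epsilon> > 0" and t: "0 \<le> t" "t \<le> t1" for \<epsilon> x t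
  proof -
    have "u \<epsilon> (x, t) \<le> u0 x + e / 3 + K * (jbracket (x - x) - 1) + C * t"
      by (rule cone_barrier[OF u_sub[OF eps] u_cont[OF eps] u_bdd[OF eps] K(1) C _ t(1)])
        (simp_all add: u_init[OF eps] K(2))
    then have "u \<epsilon> (x, t) \<le> u0 x + e / 3 + C * t" by (simp add: jbracket_def)
    moreover have "C * t \<le> (\<bar>C\<bar> + 1) * (e / (3 * (\<bar>C\<bar> + 1)))"
      using t t1(4) e by (intro mult_mono) auto
    moreover have "(\<bar>C\<bar> + 1) * (e / (3 * (\<bar>C\<bar> + 1))) = e / 3" by (simp add: field_simps)
    moreover have "dist (ubar (x, t)) (ubar (x, 0)) < e / 3"
      using d t t1 by (intro d(2)) (auto simp: dist_Pair_Pair dist_real_def)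
    ultimately show ?thesis using ubar_init[of x] unfolding dist_real_def by linarith
  qed
  with t1(1) show thesis by (rule that)
qed

text \<open>
  The constants are chosen in the order \<open>\<alpha>\<close> (doubling), \<open>P\<close> and \<open>\<eta>\<close> (penalty in time and a lower
  bound of its derivative), \<open>C\<close> (Lipschitz bound at the level of \<open>\<bar>a\<bar> \<le> d / \<alpha>\<close>), \<open>\<beta>\<close> (penalty
  in space), \<open>r\<close> (radius of the ball for the perturbed test function), \<open>s\<close> (accuracy of the
  corrector), and only then the index \<open>n\<close>. Everything before \<open>n\<close> is independent of \<open>\<epsilon>\<close>, so the
  errors, each at most a quarter of \<open>\<eta>\<close>, cannot consume \<open>\<eta>\<close>.
\<close>

lemma solution_eventually_below_limit:
  assumes K: "compact K" "K \<subseteq> UNIV \<times> {0..}" and e: "e > 0"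
  shows "\<forall>\<^sub>F \<epsilon> in at_right 0. \<forall>z\<in>K. u \<epsilon> z < ubar z + e"
proof (rule ccontr)
  assume contra: "\<not> ?thesis"
  have "\<exists>\<epsilon>. 0 < \<epsilon> \<and> \<epsilon> < 1 / real (Suc n) \<and> (\<exists>k\<in>K. ubar k + e \<le> u \<epsilon> k)" for n
    using contra unfolding eventually_at_right_field
    by (metis not_less of_nat_0_less_iff zero_less_Suc zero_less_divide_1_iff)
  then obtain \<epsilon> k where eps: "\<And>n. 0 < \<epsilon> n" "\<And>n. \<epsilon> n < 1 / real (Suc n)"
    and k: "\<And>n. k n \<in> K" "\<And>n. ubar (k n) + e \<le> u (\<epsilon> n) (k n)"
    by metis
  define \<theta> where "\<theta> = e / 4"
  have \<theta>: "\<theta> > 0" using e by (simp add: \<theta>_def)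
  obtain X where X: "\<And>z. z \<in> K \<Longrightarrow> norm z \<le> X"
    using compact_imp_bounded[OF K(1)] by (auto simp: bounded_iff)
  have X0: "X \<ge> 0" using X[OF k(1)[of 0]] norm_ge_zero order_trans by blast
  define T1 where "T1 = X + 1"
  define T2 where "T2 = T1 + 1"
  define E where "E = (UNIV :: 'a set) \<times> {0..T2}"
  have kE: "k n \<in> E" "snd (k n) \<le> X" "norm (fst (k n)) \<le> X" for n
  proof -
    show 1: "snd (k n) \<le> X" using X[OF k(1)[of n]] norm_snd_le_norm[of "k n"] by simp
    show "norm (fst (k n)) \<le> X" using X[OF k(1)[of n]] norm_fst_le_norm[of "k n"] by simp
    show "k n \<in> E" using 1 K(2) k(1)[of n] by (cases "k n") (auto simp: E_def T1_def T2_def)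
  qed
  obtain M where M: "\<And>\<epsilon> z z'. \<epsilon> > 0 \<Longrightarrow> z \<in> E \<Longrightarrow> z' \<in> E \<Longrightarrow> u \<epsilon> z - ubar z' \<le> M" and M0: "M > 0"
  proof -
    obtain M1 where M1: "\<And>\<epsilon> x t. \<epsilon> > 0 \<Longrightarrow> 0 \<le> t \<Longrightarrow> t \<le> T2 \<Longrightarrow> u \<epsilon> (x, t) \<le> M1"
      using uniform_upper_bound[of T2] by blast
    obtain M2 where M2: "\<And>x t. 0 \<le> t \<Longrightarrow> t \<le> T2 \<Longrightarrow> - M2 \<le> ubar (x, t)"
      using ubar_bdd[of T2] by (meson atLeastAtMost_iff)
    have "u \<epsilon> z - ubar z' \<le> \<bar>M1 + M2\<bar> + 1" if "\<epsilon> > 0" "z \<in> E" "z' \<in> E" for \<epsilon> z z'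
      using M1[of \<epsilon> "snd z" "fst z"] M2[of "snd z'" "fst z'"] that by (auto simp: E_def)
    moreover have "\<bar>M1 + M2\<bar> + 1 > 0" by (simp add: add_nonneg_pos)
    ultimately show thesis by (rule that)
  qed
  obtain t1 where t1: "t1 > 0"
    "\<And>\<epsilon> x t. \<epsilon> > 0 \<Longrightarrow> 0 \<le> t \<Longrightarrow> t \<le> t1 \<Longrightarrow> u \<epsilon> (x, t) \<le> ubar (x, t) + \<theta>"
    using uniform_initial_bound[OF \<theta>] by blast
  obtain d0 where d0: "d0 > 0"
    "\<And>z z'. z \<in> E \<Longrightarrow> z' \<in> E \<Longrightarrow> dist z' z < d0 \<Longrightarrow> dist (ubar z') (ubar z) < \<theta>"
    unfolding E_def by (rule uniformly_continuous_onE[OF ubar_uc[of T2] \<theta>]) blast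
  define d where "d = Min {1 / 2, t1 / 2, d0 / 2}"
  have d: "d > 0" "d \<le> 1 / 2" "d \<le> t1 / 2" "d \<le> d0 / 2"
    unfolding d_def using t1(1) d0(1)
    by (simp_all only: Min_le finite.intros insert_iff refl simp_thms) auto
  define \<alpha> where "\<alpha> = d\<^sup>2 / (2 * M)"
  have \<alpha>: "\<alpha> > 0" using d M0 by (simp add: \<alpha>_def)
  obtain l where l: "l > 0" "M * exp (- l) < \<theta>" using small_exp_penalty[OF M0 \<theta>] .
  define P where "P t = M * exp (l * (t - T1))" for t
  define \<eta> where "\<eta> = l * P 0"
  have P0: "P t > 0" for t using M0 by (simp add: P_def)
  have P_mono: "s \<le> t \<Longrightarrow> P s \<le> P t" for s t
    using M0 l(1) by (simp add: P_def)
  have \<eta>: "\<eta> > 0" "\<And>t. t \<ge> 0 \<Longrightarrow> \<eta> \<le> l * P t"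
    using P0 l(1) P_mono by (auto simp: \<eta>_def)
  obtain C0 where C0: "\<And>q1 q2 y1 y2. h q1 y1 \<le> d / \<alpha> + 1 \<Longrightarrow> - (d / \<alpha> + 1) \<le> h q2 y2
      \<Longrightarrow> norm (q1 - q2) \<le> 1 \<Longrightarrow> h q2 y2 - h q1 y1 \<le> C0 * (norm (q1 - q2) + norm (y1 - y2))"
    using lip[of "d / \<alpha> + 1"] by blast
  define C where "C = \<bar>C0\<bar>"
  have C: "C \<ge> 0" "\<And>q1 q2 y1 y2. h q1 y1 \<le> d / \<alpha> + 1 \<Longrightarrow> - (d / \<alpha> + 1) \<le> h q2 y2
      \<Longrightarrow> norm (q1 - q2) \<le> 1 \<Longrightarrow> h q2 y2 - h q1 y1 \<le> C * (norm (q1 - q2) + norm (y1 - y2))"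
  proof -
    show "C \<ge> 0" by (simp add: C_def)
    fix q1 q2 y1 y2
    assume "h q1 y1 \<le> d / \<alpha> + 1" "- (d / \<alpha> + 1) \<le> h q2 y2" "norm (q1 - q2) \<le> 1"
    from C0[OF this] have "h q2 y2 - h q1 y1 \<le> C0 * (norm (q1 - q2) + norm (y1 - y2))" .
    also have "\<dots> \<le> C * (norm (q1 - q2) + norm (y1 - y2))"
      unfolding C_def by (intro mult_right_mono) auto
    finally show "h q2 y2 - h q1 y1 \<le> C * (norm (q1 - q2) + norm (y1 - y2))" .
  qed
  define \<beta> where "\<beta> = Min {1 / 4, \<eta> / (4 * (C + 1)), \<theta> / (X + 1)}"
  have \<beta>: "\<beta> > 0" "\<beta> \<le> 1 / 4" "\<beta> \<le> \<eta> / (4 * (C + 1))" "\<beta> \<le> \<theta> / (X + 1)"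
    unfolding \<beta>_def using \<eta>(1) C(1) \<theta> X0
    by (simp_all only: Min_le finite.intros insert_iff refl simp_thms) auto
  have C\<beta>: "C * \<beta> \<le> \<eta> / 4"
  proof -
    have "C * \<beta> \<le> (C + 1) * (\<eta> / (4 * (C + 1)))" using \<beta> C(1) by (intro mult_mono) auto
    also have "\<dots> = \<eta> / 4" using C(1) by (simp add: divide_simps)
    finally show ?thesis .
  qed
  define \<Phi> where "\<Phi> \<epsilon> Z = u \<epsilon> (fst Z) - ubar (snd Z) - (norm (fst Z - snd Z))\<^sup>2 / (2 * \<alpha>)
      - \<beta> * jbracket (fst (fst Z)) - P (snd (fst Z))" for \<epsilon> and Z :: "('a \<times> real) \<times> ('a \<times> real)"
  \<comment> \<open>Wherever the doubled function is at least \<open>2 * \<theta>\<close>, the penalties are bounded by \<open>M\<close>, which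
    localizes the points; being close together they violate the initial bound unless
    \<open>snd z > t1\<close>.\<close>
  have high: "norm (z - z') \<le> d \<and> norm (fst z) \<le> M / \<beta> \<and> snd z < T1 \<and> t1 < snd z"
    if eps: "\<epsilon> > 0" and zz: "z \<in> E" "z' \<in> E" and \<Phi>: "2 * \<theta> \<le> \<Phi> \<epsilon> (z, z')" for \<epsilon> z z'
  proof -
    have nn: "0 \<le> (norm (z - z'))\<^sup>2 / (2 * \<alpha>)" "0 \<le> \<beta> * jbracket (fst z)" "0 < P (snd z)"
      using \<alpha> \<beta>(1) P0 jbracket_ge_1[of "fst z"] by auto
    note all = nn \<Phi> M[OF eps zz] \<theta>
    have "(norm (z - z'))\<^sup>2 / (2 * \<alpha>) \<le> M" using all by (simp add: \<Phi>_def)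
    then have "(norm (z - z'))\<^sup>2 \<le> d\<^sup>2" using \<alpha> M0 by (simp add: \<alpha>_def field_simps)
    then have 1: "norm (z - z') \<le> d" using d(1) power2_le_imp_le by fastforce
    have "\<beta> * jbracket (fst z) \<le> M" using all by (simp add: \<Phi>_def)
    then have 2: "norm (fst z) \<le> M / \<beta>"
      using \<beta>(1) norm_le_jbracket[of "fst z"] by (simp add: field_simps) (meson mult_left_mono order_trans less_imp_le)
    have "P (snd z) < M" using all by (simp add: \<Phi>_def)
    then have 3: "snd z < T1" using P_mono[of T1 "snd z"] by (force simp: P_def)
    have "2 * \<theta> < u \<epsilon> z - ubar z'" using all by (simp add: \<Phi>_def)
    moreover have "dist (ubar z') (ubar z) < \<theta>"
      using d0(2)[OF zz] 1 d(4) d0(1) by (simp add: dist_norm norm_minus_commute)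
    ultimately have "ubar z + \<theta> < u \<epsilon> z" unfolding dist_real_def by linarith
    then have "t1 < snd z" using t1(2)[OF eps, of "snd z" "fst z"] zz(1) by (force simp: E_def)
    with 1 2 3 show ?thesis by blast
  qed
  have \<Phi>k: "2 * \<theta> \<le> \<Phi> (\<epsilon> n) (k n, k n)" for n
  proof -
    have "jbracket (fst (k n)) \<le> X + 1"
    proof -
      have "(jbracket (fst (k n)))\<^sup>2 \<le> (X + 1)\<^sup>2"
      proof -
        have "(norm (fst (k n)))\<^sup>2 \<le> X\<^sup>2" using kE(3)[of n] by (intro power_mono) auto
        moreover have "(jbracket (fst (k n)))\<^sup>2 = 1 + (norm (fst (k n)))\<^sup>2"
          by (simp add: jbracket_def dot_square_norm add_nonneg_nonneg)
        moreover have "(X + 1)\<^sup>2 = X\<^sup>2 + 2 * X + 1" by (simp add: power2_eq_square algebra_simps)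
        ultimately show ?thesis using X0 by linarith
      qed
      then show ?thesis by (rule power2_le_imp_le) (use X0 in simp)
    qed
    then have "\<beta> * jbracket (fst (k n)) \<le> \<theta> / (X + 1) * (X + 1)"
      using \<beta> X0 \<theta> jbracket_ge_1[of "fst (k n)"] by (intro mult_mono) auto
    then have "\<beta> * jbracket (fst (k n)) \<le> \<theta>" using X0 by simp
    moreover have "P (snd (k n)) \<le> P X" using kE by (intro P_mono)
    moreover have "P X < \<theta>" using l(2) by (simp add: P_def T1_def)
    ultimately show ?thesis using k(2)[of n] by (simp add: \<Phi>_def \<theta>_def)
  qed
  have ubar_cont: "continuous_on E ubar"
    unfolding E_def by (rule uniformly_continuous_imp_continuous[OF ubar_uc])
  have "\<exists>Z. Z \<in> E \<times> E \<and> (\<forall>Z'\<in>E \<times> E. \<Phi> (\<epsilon> n) Z' \<le> \<Phi> (\<epsilon> n) Z)" for n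
  proof -
    have "closed (E \<times> E)" unfolding E_def by (intro closed_Times) auto
    moreover have "continuous_on (E \<times> E) (\<Phi> (\<epsilon> n))"
    proof -
      have "continuous_on (E \<times> E) (\<lambda>Z. u (\<epsilon> n) (fst Z))"
        by (rule continuous_on_compose2[OF u_cont[OF eps(1), of T2] continuous_on_fst])
          (auto simp: E_def intro: continuous_on_id)
      moreover have "continuous_on (E \<times> E) (\<lambda>Z. ubar (snd Z))"
        by (rule continuous_on_compose2[OF ubar_cont continuous_on_snd])
          (auto intro: continuous_on_id)
      ultimately show ?thesis unfolding \<Phi>_def P_def using \<alpha> by (auto intro!: continuous_intros)
    qed
    moreover have "(k n, k n) \<in> E \<times> E" using kE by blast
    moreover have "bounded {Z \<in> E \<times> E. \<Phi> (\<epsilon> n) (k n, k n) \<le> \<Phi> (\<epsilon> n) Z}"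
    proof (rule bounded_subset)
      let ?B = "cball (0::'a) (M / \<beta> + 1) \<times> {0..T2}"
      show "bounded (?B \<times> ?B)" by (intro bounded_Times) auto
      have "z \<in> ?B \<and> z' \<in> ?B"
        if zz: "z \<in> E" "z' \<in> E" and "\<Phi> (\<epsilon> n) (k n, k n) \<le> \<Phi> (\<epsilon> n) (z, z')" for z z'
      proof -
        have *: "norm (z - z') \<le> d \<and> norm (fst z) \<le> M / \<beta>"
          using high[OF eps(1) zz order_trans[OF \<Phi>k that(3)]] by blast
        moreover have "norm (fst z') \<le> norm (fst z) + norm (z - z')"
          using norm_triangle_ineq4[of "fst z" "fst (z - z')"] norm_fst_le_norm[of "z - z'"]
          by simp
        ultimately show ?thesis using zz d(2) by (auto simp: E_def mem_Times_iff)
      qed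
      then show "{Z \<in> E \<times> E. \<Phi> (\<epsilon> n) (k n, k n) \<le> \<Phi> (\<epsilon> n) Z} \<subseteq> ?B \<times> ?B"
        by fastforce
    qed
    ultimately show ?thesis by (rule attains_sup_if_bounded_superlevel) blast
  qed
  then obtain Z where Z: "\<And>n. Z n \<in> E \<times> E" "\<And>n Z'. Z' \<in> E \<times> E \<Longrightarrow> \<Phi> (\<epsilon> n) Z' \<le> \<Phi> (\<epsilon> n) (Z n)"
    by metis
  define z where "z n = fst (Z n)" for n
  define z' where "z' n = snd (Z n)" for n
  have zE: "z n \<in> E" "z' n \<in> E" for n using Z(1)[of n] by (auto simp: z_def z'_def mem_Times_iff)
  have zmax: "\<Phi> (\<epsilon> n) (x, y) \<le> \<Phi> (\<epsilon> n) (z n, z' n)" if "x \<in> E" "y \<in> E" for n x y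
    using Z(2)[of "(x, y)" n] that by (simp add: z_def z'_def)
  have zh: "norm (z n - z' n) \<le> d" "norm (fst (z n)) \<le> M / \<beta>" "snd (z n) < T1" "t1 < snd (z n)" for n
    using high[OF eps(1) zE order_trans[OF \<Phi>k zmax[OF kE(1) kE(1)]]] by blast+
  obtain Z0 \<sigma> where \<sigma>: "strict_mono \<sigma>" and lim: "(Z \<circ> \<sigma>) \<longlonglongrightarrow> Z0"
  proof -
    have "compact ((cball (0::'a) (M / \<beta> + 1) \<times> {0..T2}) \<times> (cball (0::'a) (M / \<beta> + 1) \<times> {0..T2}))"
      by (intro compact_Times) auto
    then have "seq_compact ((cball (0::'a) (M / \<beta> + 1) \<times> {0..T2}) \<times> (cball (0::'a) (M / \<beta> + 1) \<times> {0..T2}))"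
      by (rule compact_imp_seq_compact)
    moreover have "Z n \<in> (cball (0::'a) (M / \<beta> + 1) \<times> {0..T2}) \<times> (cball (0::'a) (M / \<beta> + 1) \<times> {0..T2})" for n
    proof -
      have "norm (fst (z' n)) \<le> norm (fst (z n)) + norm (z n - z' n)"
        using norm_triangle_ineq4[of "fst (z n)" "fst (z n - z' n)"]
          norm_fst_le_norm[of "z n - z' n"] by simp
      then show ?thesis using zE[of n] zh[of n] d(2)
        by (auto simp: E_def mem_Times_iff z_def z'_def)
    qed
    ultimately show thesis using that unfolding seq_compact_def by metis
  qed
  define \<zeta> where "\<zeta> = fst Z0"
  define \<zeta>' where "\<zeta>' = snd Z0"
  have lim1: "(\<lambda>n. z (\<sigma> n)) \<longlonglongrightarrow> \<zeta>" and lim2: "(\<lambda>n. z' (\<sigma> n)) \<longlonglongrightarrow> \<zeta>'"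
    using tendsto_fst[OF lim] tendsto_snd[OF lim] by (simp_all add: z_def z'_def \<zeta>_def \<zeta>'_def o_def)
  have \<zeta>'E: "\<zeta>' \<in> E"
    by (rule closed_sequentially[OF _ _ lim2]) (auto simp: E_def zE[unfolded E_def] intro!: closed_Times)
  have \<zeta>d: "norm (\<zeta> - \<zeta>') \<le> d"
    by (rule LIMSEQ_le_const2[OF tendsto_norm[OF tendsto_diff[OF lim1 lim2]]]) (use zh in auto)
  have s\<zeta>: "t1 \<le> snd \<zeta>" "snd \<zeta> \<le> T1"
    by (rule LIMSEQ_le_const[OF tendsto_snd[OF lim1]], use zh(4) less_imp_le in blast,
        rule LIMSEQ_le_const2[OF tendsto_snd[OF lim1]], use zh(3) less_imp_le in blast)
  have s\<zeta>d: "\<bar>snd \<zeta> - snd \<zeta>'\<bar> \<le> d"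
    using \<zeta>d norm_snd_le_norm[of "\<zeta> - \<zeta>'"] by simp
  define p where "p = fst (\<zeta> - \<zeta>') /\<^sub>R \<alpha>"
  define a where "a = snd (\<zeta> - \<zeta>') / \<alpha>"
  have a: "\<bar>a\<bar> \<le> d / \<alpha>" using s\<zeta>d \<alpha> by (simp add: a_def divide_right_mono)
  \<comment> \<open>The minimum property of \<open>ubar\<close> passes to the limit, where the test function is centred
    at \<open>\<zeta>\<close>; this yields the inequality at the limit slope itself.\<close>
  have limit_slope: "0 \<le> a + hbar p"
  proof -
    define \<psi> where "\<psi> y = - (norm (\<zeta> - y))\<^sup>2 / (2 * \<alpha>)" for y
    have min: "ubar \<zeta>' - \<psi> \<zeta>' \<le> ubar y - \<psi> y" if "y \<in> E" for y
    proof -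
      have "ubar (z' n) + (norm (z n - z' n))\<^sup>2 / (2 * \<alpha>) \<le> ubar y + (norm (z n - y))\<^sup>2 / (2 * \<alpha>)" for n
        using zmax[OF zE(1)[of n] that, of n] by (simp add: \<Phi>_def)
      moreover have "(\<lambda>n. ubar (z' (\<sigma> n)) + (norm (z (\<sigma> n) - z' (\<sigma> n)))\<^sup>2 / (2 * \<alpha>))
          \<longlonglongrightarrow> ubar \<zeta>' + (norm (\<zeta> - \<zeta>'))\<^sup>2 / (2 * \<alpha>)"
        by (intro tendsto_intros lim1 lim2 continuous_on_tendsto_compose[OF ubar_cont lim2 \<zeta>'E])
          (use zE \<alpha> in auto)
      moreover have "(\<lambda>n. ubar y + (norm (z (\<sigma> n) - y))\<^sup>2 / (2 * \<alpha>))
          \<longlonglongrightarrow> ubar y + (norm (\<zeta> - y))\<^sup>2 / (2 * \<alpha>)"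
        by (intro tendsto_intros lim1) (use \<alpha> in auto)
      ultimately have "ubar \<zeta>' + (norm (\<zeta> - \<zeta>'))\<^sup>2 / (2 * \<alpha>) \<le> ubar y + (norm (\<zeta> - y))\<^sup>2 / (2 * \<alpha>)"
        by (intro LIMSEQ_le) auto
      then show ?thesis by (simp add: \<psi>_def)
    qed
    have s: "0 < snd \<zeta>'" "snd \<zeta>' < T2" using s\<zeta> s\<zeta>d d t1(1) by (auto simp: T2_def)
    have "0 \<le> (\<lambda>(x, t) r (q, a). a + hbar q) \<zeta>' (ubar \<zeta>') ((\<zeta> - \<zeta>') /\<^sub>R \<alpha>)"
    proof (rule viscosity_supersolution_at_local_min[OF ubar_super, where D\<phi> = "\<lambda>y. (\<zeta> - y) /\<^sub>R \<alpha>"])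
      show "\<zeta>' \<in> UNIV \<times> {0<..}" using s by (simp add: mem_Times_iff)
      show "T2 - snd \<zeta>' > 0" using s by simp
      show "continuous_on (UNIV \<times> {0<..}) (\<lambda>y. (\<zeta> - y) /\<^sub>R \<alpha>)" by (intro continuous_intros)
      show "GDERIV \<psi> y :> (\<zeta> - y) /\<^sub>R \<alpha>" for y
      proof -
        have "((\<lambda>y. (norm (\<zeta> - y))\<^sup>2 / (2 * (- \<alpha>))) has_derivative
            (\<lambda>h. (- h) \<bullet> ((\<zeta> - y) /\<^sub>R (- \<alpha>)))) (at y)"
          by (intro has_derivative_quadratic_penalty) (auto intro!: derivative_eq_intros)
        then show ?thesis by (simp add: gderiv_def \<psi>_def[abs_def])
      qed
      fix y :: "'a \<times> real" assume "y \<in> UNIV \<times> {0<..}" "dist y \<zeta>' < T2 - snd \<zeta>'"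
      then have "y \<in> E" using dist_snd_le[of y \<zeta>'] by (auto simp: E_def mem_Times_iff dist_real_def)
      then show "ubar \<zeta>' - \<psi> \<zeta>' \<le> ubar y - \<psi> y" by (rule min)
    qed
    then show ?thesis by (simp add: a_def p_def case_prod_beta divide_inverse_commute)
  qed
  \<comment> \<open>On the ball of radius \<open>r\<close> the gradient of the test function varies by at most \<open>m * r\<close>: the
    doubling penalty contributes \<open>2 * r / \<alpha>\<close>, the localizing square \<open>2 * r\<close>.\<close>
  define m where "m = 2 / \<alpha> + 2"
  have m: "m > 0" using \<alpha> by (simp add: m_def add_pos_pos)
  define r where "r = Min {t1 / 2, 1 / 2, 1 / (4 * m), \<eta> / (4 * (C + 1) * m)}"
  have r: "r > 0" "r \<le> t1 / 2" "r \<le> 1 / 2" "r \<le> 1 / (4 * m)" "r \<le> \<eta> / (4 * (C + 1) * m)"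
    unfolding r_def using t1(1) m \<eta>(1) C(1)
    by (simp_all only: Min_le finite.intros insert_iff refl simp_thms) auto
  have mr: "m * r \<le> 1 / 4" "(C + 1) * (m * r) \<le> \<eta> / 4"
  proof -
    have "m * r \<le> m * (1 / (4 * m))" using r(4) m by (intro mult_left_mono) auto
    then show "m * r \<le> 1 / 4" using m by simp
    have "(C + 1) * (m * r) \<le> (C + 1) * (m * (\<eta> / (4 * (C + 1) * m)))"
      using r(5) m C(1) by (intro mult_left_mono) auto
    also have "\<dots> = \<eta> / 4" using m C(1) by (simp add: divide_simps)
    finally show "(C + 1) * (m * r) \<le> \<eta> / 4" .
  qed
  define s where "s = min (\<eta> / 4) (r\<^sup>2 / 4)"
  have s: "s > 0" "s \<le> \<eta> / 4" "2 * s < r\<^sup>2" "s \<le> 1"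
  proof -
    have r2: "0 < r\<^sup>2" "r\<^sup>2 \<le> 1" using r by (simp, intro power_le_one) auto
    have "s \<le> r\<^sup>2 / 4" unfolding s_def by (rule min.cobounded2)
    with r2 show "2 * s < r\<^sup>2" "s \<le> 1" by linarith+
    show "s > 0" "s \<le> \<eta> / 4" using \<eta>(1) r2 by (auto simp: s_def)
  qed
  have "\<forall>\<^sub>F n in sequentially. \<forall>y. norm (\<epsilon> (\<sigma> n) *\<^sub>R y) < M / \<beta> + 3
      \<longrightarrow> \<bar>hbar p + \<epsilon> (\<sigma> n) * w p (\<epsilon> (\<sigma> n)) y\<bar> \<le> s"
  proof -
    have "(\<lambda>n. \<epsilon> n) \<longlonglongrightarrow> 0"
      by (rule tendsto_sandwich[OF _ _ tendsto_const LIMSEQ_inverse_real_of_nat])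
        (use eps in \<open>auto intro!: always_eventually less_imp_le simp: inverse_eq_divide\<close>)
    then have "(\<lambda>n. \<epsilon> (\<sigma> n)) \<longlonglongrightarrow> 0"
      using LIMSEQ_subseq_LIMSEQ[OF _ \<sigma>] by (fastforce simp: o_def)
    then have "filterlim (\<lambda>n. \<epsilon> (\<sigma> n)) (at_right 0) sequentially"
      using eps(1) by (simp add: filterlim_at less_imp_neq[THEN not_sym])
    moreover have "M / \<beta> + 3 > 0" using M0 \<beta>(1) by (simp add: add_pos_pos)
    ultimately show ?thesis using eventually_compose_filterlim[OF w_conv[OF _ s(1)]] by blast
  qed
  moreover have "\<forall>\<^sub>F n in sequentially. dist (z (\<sigma> n) - z' (\<sigma> n)) (\<zeta> - \<zeta>') < r"
    using tendstoD[OF tendsto_diff[OF lim1 lim2] r(1)] .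
  ultimately have "\<forall>\<^sub>F n in sequentially. (\<forall>y. norm (\<epsilon> (\<sigma> n) *\<^sub>R y) < M / \<beta> + 3
      \<longrightarrow> \<bar>hbar p + \<epsilon> (\<sigma> n) * w p (\<epsilon> (\<sigma> n)) y\<bar> \<le> s)
      \<and> dist (z (\<sigma> n) - z' (\<sigma> n)) (\<zeta> - \<zeta>') < r"
    by (rule eventually_conj)
  from eventually_happens'[OF sequentially_bot this] obtain n where
    n: "\<And>y. norm (\<epsilon> (\<sigma> n) *\<^sub>R y) < M / \<beta> + 3 \<Longrightarrow> \<bar>hbar p + \<epsilon> (\<sigma> n) * w p (\<epsilon> (\<sigma> n)) y\<bar> \<le> s"
      "norm ((z (\<sigma> n) - z' (\<sigma> n)) - (\<zeta> - \<zeta>')) < r"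
    unfolding dist_norm by blast
  define N where "N = \<sigma> n"
  \<comment> \<open>The last square makes the maximum at \<open>z N\<close> strict with a definite gap.\<close>
  define \<phi> where "\<phi> x = (norm (x - z' N))\<^sup>2 / (2 * \<alpha>) + \<beta> * jbracket (fst x) + P (snd x)
      + (norm (x - z N))\<^sup>2" for x
  define D\<phi> where "D\<phi> x = (x - z' N) /\<^sub>R \<alpha> + (\<beta> *\<^sub>R jgrad (fst x), l * P (snd x))
      + 2 *\<^sub>R (x - z N)" for x
  have slope: "norm ((x - z' N) /\<^sub>R \<alpha> + 2 *\<^sub>R (x - z N) - (\<zeta> - \<zeta>') /\<^sub>R \<alpha>) \<le> m * r"
    if "x \<in> cball (z N) r" for x
  proof -
    have x: "norm (x - z N) \<le> r" using that by (simp add: dist_norm norm_minus_commute)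
    have "(x - z' N) /\<^sub>R \<alpha> + 2 *\<^sub>R (x - z N) - (\<zeta> - \<zeta>') /\<^sub>R \<alpha>
        = ((x - z N) + ((z N - z' N) - (\<zeta> - \<zeta>'))) /\<^sub>R \<alpha> + 2 *\<^sub>R (x - z N)"
      by (simp add: algebra_simps)
    also have "norm \<dots> \<le> norm ((x - z N) + ((z N - z' N) - (\<zeta> - \<zeta>'))) / \<alpha> + 2 * norm (x - z N)"
      by (rule order_trans[OF norm_triangle_ineq]) (use \<alpha> in \<open>simp add: divide_inverse_commute\<close>)
    also have "\<dots> \<le> (r + r) / \<alpha> + 2 * r"
    proof (intro add_mono divide_right_mono mult_left_mono)
      show "norm ((x - z N) + ((z N - z' N) - (\<zeta> - \<zeta>'))) \<le> r + r"
        using norm_triangle_ineq[of "x - z N" "(z N - z' N) - (\<zeta> - \<zeta>')"] x n(2)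
        unfolding N_def by linarith
    qed (use x \<alpha> in auto)
    also have "\<dots> = m * r" by (simp add: m_def field_simps)
    finally show ?thesis .
  qed
  have cball_E: "x \<in> E" if "x \<in> cball (z N) r" for x
    using that dist_snd_le[of "z N" x] zh[of N] r
    by (auto simp: E_def mem_Times_iff dist_real_def T2_def)
  have "(a + \<eta> - m * r) + hbar p \<le> C * (m * r + \<beta>) + s"
  proof (rule perturbed_test_function[OF u_sub[OF eps(1)] w_super[OF eps(1)] eps(1)[of N] w_cont[OF eps(1)]
        C(2) C(1) r(1), where \<phi> = \<phi> and D\<phi> = D\<phi> and ?z0.0 = "z N"])
    show "r < snd (z N)" using r zh(4)[of N] t1(1) by simp
    show "continuous_on (cball (z N) r) (u (\<epsilon> N))"
      using cball_E by (intro continuous_on_subset[OF u_cont[OF eps(1), of T2]]) (auto simp: E_def)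
    show "GDERIV \<phi> x :> D\<phi> x" for x
    proof -
      have "((\<lambda>x. (norm (x - z' N))\<^sup>2 / (2 * \<alpha>)) has_derivative
          (\<lambda>h. h \<bullet> ((x - z' N) /\<^sub>R \<alpha>))) (at x)"
        by (intro has_derivative_quadratic_penalty) (auto intro!: derivative_eq_intros)
      moreover have "((\<lambda>x. (norm (x - z N))\<^sup>2) has_derivative (\<lambda>h. 2 * (h \<bullet> (x - z N)))) (at x)"
        by (intro has_derivative_norm_square) (auto intro!: derivative_eq_intros)
      moreover have "((\<lambda>x. \<beta> * jbracket (fst x) + P (snd x)) has_derivative
          (\<lambda>h. h \<bullet> (\<beta> *\<^sub>R jgrad (fst x), l * P (snd x)))) (at x)"
        unfolding P_def by (auto intro!: derivative_eq_intros simp: inner_prod_def)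
      ultimately have "((\<lambda>x. (norm (x - z' N))\<^sup>2 / (2 * \<alpha>) + (\<beta> * jbracket (fst x) + P (snd x))
          + (norm (x - z N))\<^sup>2) has_derivative (\<lambda>h. h \<bullet> ((x - z' N) /\<^sub>R \<alpha>)
            + h \<bullet> (\<beta> *\<^sub>R jgrad (fst x), l * P (snd x)) + 2 * (h \<bullet> (x - z N)))) (at x)"
        by (intro has_derivative_add)
      then show ?thesis
        by (simp only: gderiv_def \<phi>_def[abs_def] D\<phi>_def inner_add_right inner_scaleR_right add.assoc)
    qed
    show "continuous_on UNIV D\<phi>"
      unfolding D\<phi>_def P_def by (intro continuous_intros)
    fix x assume x: "x \<in> cball (z N) r"
    show "u (\<epsilon> N) x - \<phi> x + (norm (x - z N))\<^sup>2 \<le> u (\<epsilon> N) (z N) - \<phi> (z N)"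
      using zmax[OF cball_E[OF x] zE(2)[of N], of N] by (simp add: \<Phi>_def \<phi>_def)
    have f: "fst (D\<phi> x) - p = fst ((x - z' N) /\<^sub>R \<alpha> + 2 *\<^sub>R (x - z N) - (\<zeta> - \<zeta>') /\<^sub>R \<alpha>)
        + \<beta> *\<^sub>R jgrad (fst x)"
      by (simp add: D\<phi>_def p_def)
    have "norm (\<beta> *\<^sub>R jgrad (fst x)) \<le> \<beta>"
      using \<beta>(1) norm_jgrad_le_1[of "fst x"] by (simp add: mult_left_le)
    moreover have "norm (fst ((x - z' N) /\<^sub>R \<alpha> + 2 *\<^sub>R (x - z N) - (\<zeta> - \<zeta>') /\<^sub>R \<alpha>)) \<le> m * r"
      by (rule order_trans[OF norm_fst_le_norm slope[OF x]])
    ultimately show "norm (fst (D\<phi> x) - p) \<le> m * r + \<beta>"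
      unfolding f by (intro norm_triangle_mono)
    have "\<bar>snd ((x - z' N) /\<^sub>R \<alpha> + 2 *\<^sub>R (x - z N) - (\<zeta> - \<zeta>') /\<^sub>R \<alpha>)\<bar> \<le> m * r"
      using order_trans[OF norm_snd_le_norm slope[OF x]] by (simp only: real_norm_def)
    moreover have "snd (D\<phi> x) - a = snd ((x - z' N) /\<^sub>R \<alpha> + 2 *\<^sub>R (x - z N) - (\<zeta> - \<zeta>') /\<^sub>R \<alpha>)
        + l * P (snd x)"
      by (simp add: D\<phi>_def a_def divide_inverse_commute)
    moreover have "\<eta> \<le> l * P (snd x)"
      using cball_E[OF x] by (intro \<eta>(2)) (auto simp: E_def)
    ultimately show "a + \<eta> - m * r \<le> snd (D\<phi> x)" by linarith
  next
    fix y assume "norm (\<epsilon> N *\<^sub>R y - fst (z N)) \<le> 2 * r"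
    then have "norm (\<epsilon> N *\<^sub>R y) \<le> 2 * r + norm (fst (z N))"
      using norm_triangle_sub[of "\<epsilon> N *\<^sub>R y" "fst (z N)"] by linarith
    then show "\<bar>hbar p + \<epsilon> N * w p (\<epsilon> N) y\<bar> \<le> s"
      using n(1)[of y] zh(2)[of N] r(3) unfolding N_def by linarith
  next
    show "m * r + \<beta> \<le> 1" using mr \<beta> by linarith
    show "2 * s < r\<^sup>2" by (rule s)
    show "- (a + \<eta> - m * r) \<le> d / \<alpha> + 1" using a mr \<eta>(1) by linarith
    show "s - hbar p \<le> d / \<alpha> + 1" using a s limit_slope by linarith
  qed
  moreover have "C * (m * r + \<beta>) + m * r \<le> \<eta> / 4 + \<eta> / 4"
    using mr C\<beta> by (simp add: algebra_simps)
  ultimately show False using limit_slope s \<eta>(1) by linarith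
qed

end

section \<open>Homogenization\<close>

lemma cauchy_solution_regular:
  assumes "cauchy_solution G u0 u"
  shows "uniformly_continuous_on (UNIV \<times> {0..T}) u"
    and "\<exists>M. \<forall>x. \<forall>t\<in>{0..T}. \<bar>u (x, t)\<bar> \<le> M"
proof -
  have reg: "bounded (u ` (UNIV \<times> {0..<\<bar>T\<bar> + 1}))"
    "uniformly_continuous_on (UNIV \<times> {0..<\<bar>T\<bar> + 1}) u"
    using assms by (simp_all add: cauchy_solution_def add_nonneg_pos)
  show "uniformly_continuous_on (UNIV \<times> {0..T}) u"
    using reg(2) unfolding uniformly_continuous_on_def by (fastforce)
  from reg(1) obtain M where "\<And>z. z \<in> UNIV \<times> {0..<\<bar>T\<bar> + 1} \<Longrightarrow> \<bar>u z\<bar> \<le> M"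
    by (auto simp: bounded_iff)
  then have "\<forall>x. \<forall>t\<in>{0..T}. \<bar>u (x, t)\<bar> \<le> M" by auto
  then show "\<exists>M. \<forall>x. \<forall>t\<in>{0..T}. \<bar>u (x, t)\<bar> \<le> M" by blast
qed

lemma (in random_hamiltonian) coercive_sublevel:
  assumes "\<omega> \<in> space M"
  obtains R where "R > 0" and "\<And>q y. H q y \<omega> \<le> B \<Longrightarrow> norm q < R"
proof -
  have "\<forall>\<^sub>F p in at_infinity. ereal B < (INF (y, \<omega>) \<in> UNIV \<times> space M. ereal (H p y \<omega>))"
    using H_coercive by (simp add: tendsto_PInfty)
  then obtain b where b: "\<And>p. b \<le> norm p \<Longrightarrow> ereal B < (INF (y, \<omega>) \<in> UNIV \<times> space M. ereal (H p y \<omega>))"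
    by (auto simp: eventually_at_infinity)
  have "norm q < max b 1" if "H q y \<omega> \<le> B" for q y
  proof (rule ccontr)
    assume "\<not> norm q < max b 1"
    then have "ereal B < (INF (y, \<omega>) \<in> UNIV \<times> space M. ereal (H q y \<omega>))" by (intro b) simp
    also have "\<dots> \<le> ereal (H q y \<omega>)"
      using assms by (intro INF_lower2[of "(y, \<omega>)"]) auto
    finally show False using that by simp
  qed
  then show thesis by (intro that[of "max b 1"]) auto
qed

text \<open>
  Coercivity turns the bound on one value of \<open>H\<close> into a ball containing both slopes. The two-sided
  conclusion serves \<open>H\<close> with the bounded value at \<open>q1\<close> and its reflection with the
  bounded value at \<open>q2\<close>.
\<close>

lemma (in random_hamiltonian) lipschitz_near_sublevel:
  assumes "\<omega> \<in> space M"
  obtains C where "\<And>q1 q2 y1 y2. H q1 y1 \<omega> \<le> B \<Longrightarrow> norm (q1 - q2) \<le> 1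
      \<Longrightarrow> \<bar>H q1 y1 \<omega> - H q2 y2 \<omega>\<bar> \<le> C * (norm (q1 - q2) + norm (y1 - y2))"
proof -
  obtain R where R: "R > 0" "\<And>q y. H q y \<omega> \<le> B \<Longrightarrow> norm q < R"
    by (rule coercive_sublevel[OF assms, of B]) blast
  obtain C where C: "\<forall>p1\<in>ball 0 (R + 1). \<forall>p2\<in>ball 0 (R + 1). \<forall>y1 y2. \<forall>\<omega>\<in>space M.
      \<bar>H p1 y1 \<omega> - H p2 y2 \<omega>\<bar> \<le> C * (norm (p1 - p2) + norm (y1 - y2))"
    using H_lipschitz[of "R + 1"] R(1) by auto
  have "\<bar>H q1 y1 \<omega> - H q2 y2 \<omega>\<bar> \<le> C * (norm (q1 - q2) + norm (y1 - y2))"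
    if q: "H q1 y1 \<omega> \<le> B" "norm (q1 - q2) \<le> 1" for q1 q2 y1 y2
  proof -
    have "norm q1 < R" by (rule R(2)[OF q(1)])
    moreover have "norm q2 \<le> norm q1 + norm (q1 - q2)" using norm_triangle_sub[of q2 q1]
      by (simp add: norm_minus_commute)
    ultimately show ?thesis using C assms q(2) by simp
  qed
  then show thesis by (rule that)
qed

lemma corrector_converges:
  fixes v :: "real \<Rightarrow> 'a::real_normed_vector \<Rightarrow> real"
  assumes bdd: "\<And>\<delta>. \<delta> > 0 \<Longrightarrow> bounded (range (v \<delta>))"
    and lim: "((\<lambda>\<delta>. SUP x\<in>ball 0 (R / \<delta>). \<bar>c + \<delta> * v \<delta> x\<bar>) \<longlongrightarrow> 0) (at_right 0)"
    and s: "s > 0"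
  shows "\<forall>\<^sub>F \<delta> in at_right 0. \<forall>y. norm (\<delta> *\<^sub>R y) < R \<longrightarrow> \<bar>c + \<delta> * v \<delta> y\<bar> \<le> s"
proof -
  have "\<forall>\<^sub>F \<delta> in at_right (0::real). 0 < \<delta>" by (rule eventually_at_right_less)
  with order_tendstoD(2)[OF lim s] show ?thesis
  proof eventually_elim
    case (elim \<delta>)
    obtain N where N: "\<And>x. \<bar>v \<delta> x\<bar> \<le> N" using bdd[OF elim(2)] by (auto simp: bounded_iff)
    have "\<bar>c + \<delta> * v \<delta> x\<bar> \<le> \<bar>c\<bar> + \<delta> * N" for x
    proof -
      have "\<bar>\<delta> * v \<delta> x\<bar> \<le> \<delta> * N" using N[of x] elim(2) by (simp add: abs_mult)
      then show ?thesis using abs_triangle_ineq[of c "\<delta> * v \<delta> x"] by linarith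
    qed
    \<comment> \<open>A real supremum bounds its members only for bounded families, so boundedness of the
      corrector is essential here.\<close>
    then have "bdd_above ((\<lambda>x. \<bar>c + \<delta> * v \<delta> x\<bar>) ` ball 0 (R / \<delta>))"
      by (intro bdd_aboveI2)
    then have "\<bar>c + \<delta> * v \<delta> y\<bar> \<le> (SUP x\<in>ball 0 (R / \<delta>). \<bar>c + \<delta> * v \<delta> x\<bar>)"
      if "norm (\<delta> *\<^sub>R y) < R" for y
      using that elim(2) by (intro cSUP_upper) (simp_all add: field_simps)
    with elim(1) show ?case by (auto intro: order_trans less_imp_le)
  qed
qed

theorem theorem7p3:
  fixes M :: "'w measure"
    and \<tau> :: "real ^ 'd \<Rightarrow> 'w \<Rightarrow> 'w"
    and H :: "real ^ 'd \<Rightarrow> real ^ 'd \<Rightarrow> 'w \<Rightarrow> real"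
    and v :: "real ^ 'd \<Rightarrow> real \<Rightarrow> 'w \<Rightarrow> real ^ 'd \<Rightarrow> real"
    and Hbar :: "real ^ 'd \<Rightarrow> real"
    and u0 :: "real ^ 'd \<Rightarrow> real"
    and \<Omega>6 :: "'w set" and \<omega> :: 'w
    and u :: "real \<Rightarrow> (real ^ 'd) \<times> real \<Rightarrow> real"
    and ubar :: "(real ^ 'd) \<times> real \<Rightarrow> real"
  assumes "random_hamiltonian M \<tau> H"
    and "\<And>p \<delta> \<omega>'. \<delta> > 0 \<Longrightarrow> \<omega>' \<in> space M \<Longrightarrow> approx_corrector H p \<delta> \<omega>' (v p \<delta> \<omega>')"
    and "effective_hamiltonian M v Hbar"
    and "\<Omega>6 \<in> sets M" and "measure M \<Omega>6 = 1"
    and "\<And>\<omega>' p R. \<omega>' \<in> \<Omega>6 \<Longrightarrow> p \<in> homogenizing_slopes Hbar \<Longrightarrow> R > 0 \<Longrightarrow>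
           ((\<lambda>\<delta>. SUP x\<in>ball 0 (R / \<delta>). \<bar>Hbar p + \<delta> * v p \<delta> \<omega>' x\<bar>) \<longlongrightarrow> 0) (at_right 0)"
    and "bounded (range u0)" and "uniformly_continuous_on UNIV u0"
    and "homogenizing_slopes Hbar = UNIV"
    and "\<omega> \<in> \<Omega>6"
    and "\<And>\<epsilon>. \<epsilon> > 0 \<Longrightarrow> cauchy_solution (\<lambda>q x. H q (x /\<^sub>R \<epsilon>) \<omega>) u0 (u \<epsilon>)"
    and "cauchy_solution (\<lambda>q x. Hbar q) u0 ubar"
  shows "\<forall>K. compact K \<and> K \<subseteq> UNIV \<times> {0..} \<longrightarrow> uniform_limit K u ubar (at_right 0)"
proof -
  interpret random_hamiltonian M \<tau> H by (rule assms(1))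
  have \<omega>: "\<omega> \<in> space M" using assms(4,10) sets.sets_into_space by blast
  note u = assms(11) and ubar = assms(12)
  have v: "bounded (range (v p \<delta> \<omega>))" "continuous_on UNIV (v p \<delta> \<omega>)"
    "viscosity_subsolution UNIV (\<lambda>x r q. \<delta> * r + H (p + q) x \<omega>) (v p \<delta> \<omega>)"
    "viscosity_supersolution UNIV (\<lambda>x r q. \<delta> * r + H (p + q) x \<omega>) (v p \<delta> \<omega>)"
    if "\<delta> > 0" for p \<delta>
    using assms(2)[OF that \<omega>, of p] lipschitz_on_continuous_on
    by (auto simp: approx_corrector_def viscosity_solution_def)
  have conv: "\<forall>\<^sub>F \<delta> in at_right 0. \<forall>y. norm (\<delta> *\<^sub>R y) < R \<longrightarrow> \<bar>Hbar p + \<delta> * v p \<delta> \<omega> y\<bar> \<le> s"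
    if "R > 0" "s > 0" for p R s
    by (rule corrector_converges[OF v(1) assms(6) that(2)]) (use that assms(9,10) in auto)
  have visc: "viscosity_subsolution (UNIV \<times> {0<..}) (\<lambda>(x, t) r (q, a). a + G q x) f"
    "viscosity_supersolution (UNIV \<times> {0<..}) (\<lambda>(x, t) r (q, a). a + G q x) f"
    "f (x, 0) = f0 x"
    if "cauchy_solution G f0 f"
    for G :: "real ^ 'd \<Rightarrow> real ^ 'd \<Rightarrow> real" and f0 :: "real ^ 'd \<Rightarrow> real" and f x
    using that by (auto simp: cauchy_solution_def viscosity_solution_def)
  have bound: "\<exists>C. \<forall>q y. norm q \<le> K \<longrightarrow> \<bar>H q y \<omega>\<bar> \<le> C" for K
    using H_bounded[of "\<bar>K\<bar> + 1"] \<omega> by (force simp: add_nonneg_pos)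
  interpret upper: one_sided_homogenization "\<lambda>q y. H q y \<omega>" Hbar "\<lambda>p \<delta>. v p \<delta> \<omega>" u0 u ubar
  proof
    show "\<exists>C. \<forall>q1 q2 y1 y2. H q1 y1 \<omega> \<le> B \<longrightarrow> - B \<le> H q2 y2 \<omega> \<longrightarrow> norm (q1 - q2) \<le> 1
      \<longrightarrow> H q2 y2 \<omega> - H q1 y1 \<omega> \<le> C * (norm (q1 - q2) + norm (y1 - y2))" for B
      using lipschitz_near_sublevel[OF \<omega>, of B] by (smt (verit, best))
    show "\<exists>C. \<forall>q y. norm q \<le> K \<longrightarrow> - C \<le> H q y \<omega>" for K
      using bound[of K] by (meson abs_le_iff minus_le_iff)
    show "continuous_on (UNIV \<times> {0..T}) (u \<epsilon>)" if "\<epsilon> > 0" for \<epsilon> T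
      by (rule uniformly_continuous_imp_continuous[OF cauchy_solution_regular(1)[OF u[OF that]]])
    show "\<exists>M. \<forall>x. \<forall>t\<in>{0..T}. u \<epsilon> (x, t) \<le> M" if "\<epsilon> > 0" for \<epsilon> T
      using cauchy_solution_regular(2)[OF u[OF that]] by (meson abs_le_iff)
    show "\<exists>M. \<forall>x. \<forall>t\<in>{0..T}. - M \<le> ubar (x, t)" for T
      using cauchy_solution_regular(2)[OF ubar] by (meson abs_le_iff minus_le_iff)
  qed (use v conv visc[OF u] visc[OF ubar] cauchy_solution_regular(1)[OF ubar] assms(7,8) in auto)
  \<comment> \<open>The reflected problem; its correctors are those of \<open>H\<close> at the opposite slope.\<close>
  interpret lower: one_sided_homogenization "\<lambda>q y. - H (- q) y \<omega>" "\<lambda>p. - Hbar (- p)"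
    "\<lambda>p \<delta> y. - v (- p) \<delta> \<omega> y" "\<lambda>x. - u0 x" "\<lambda>\<epsilon> z. - u \<epsilon> z" "\<lambda>z. - ubar z"
  proof
    show "\<exists>C. \<forall>q1 q2 y1 y2. - H (- q1) y1 \<omega> \<le> B \<longrightarrow> - B \<le> - H (- q2) y2 \<omega> \<longrightarrow> norm (q1 - q2) \<le> 1
      \<longrightarrow> - H (- q2) y2 \<omega> - - H (- q1) y1 \<omega> \<le> C * (norm (q1 - q2) + norm (y1 - y2))" for B
    proof -
      obtain C where C: "\<And>q1 q2 y1 y2. H q1 y1 \<omega> \<le> B \<Longrightarrow> norm (q1 - q2) \<le> 1
          \<Longrightarrow> \<bar>H q1 y1 \<omega> - H q2 y2 \<omega>\<bar> \<le> C * (norm (q1 - q2) + norm (y1 - y2))"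
        using lipschitz_near_sublevel[OF \<omega>, of B] by blast
      have "- H (- q2) y2 \<omega> - - H (- q1) y1 \<omega> \<le> C * (norm (q1 - q2) + norm (y1 - y2))"
        if "- B \<le> - H (- q2) y2 \<omega>" "norm (q1 - q2) \<le> 1" for q1 q2 y1 y2
        using C[of "- q2" y2 "- q1" y1] that by (simp add: norm_minus_commute abs_le_iff)
      then show ?thesis by blast
    qed
    show "\<exists>C. \<forall>q y. norm q \<le> K \<longrightarrow> - C \<le> - H (- q) y \<omega>" for K
      using bound[of K] by (metis abs_le_iff neg_le_iff_le norm_minus_cancel)
    show "viscosity_supersolution UNIV (\<lambda>y r q. \<delta> * r + - H (- (p + q)) y \<omega>) (\<lambda>y. - v (- p) \<delta> \<omega> y)"
      if "\<delta> > 0" for p \<delta>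
      by (rule viscosity_supersolution_uminus[OF v(3)[OF that, of "- p"]]) simp
    show "continuous_on UNIV (\<lambda>y. - v (- p) \<delta> \<omega> y)" if "\<delta> > 0" for p \<delta>
      using v(2)[OF that] by (intro continuous_on_minus)
    show "\<forall>\<^sub>F \<delta> in at_right 0. \<forall>y. norm (\<delta> *\<^sub>R y) < R
        \<longrightarrow> \<bar>- Hbar (- p) + \<delta> * - v (- p) \<delta> \<omega> y\<bar> \<le> s" if "R > 0" "s > 0" for p R s
    proof -
      have "\<bar>- Hbar (- p) + \<delta> * - v (- p) \<delta> \<omega> y\<bar> = \<bar>Hbar (- p) + \<delta> * v (- p) \<delta> \<omega> y\<bar>" for \<delta> y
        by (simp add: abs_if)
      then show ?thesis using conv[OF that, of "- p"] by simp
    qed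
    show "bounded (range (\<lambda>x. - u0 x))"
      using assms(7) by (simp add: bounded_iff)
    show "uniformly_continuous_on UNIV (\<lambda>x. - u0 x)"
      by (rule uniformly_continuous_on_minus[OF assms(8)])
    show "viscosity_subsolution (UNIV \<times> {0<..})
        (\<lambda>(x, t) r (q, a). a + - H (- q) (x /\<^sub>R \<epsilon>) \<omega>) (\<lambda>z. - u \<epsilon> z)" if "\<epsilon> > 0" for \<epsilon>
      by (rule viscosity_subsolution_uminus[OF visc(2)[OF u[OF that]]]) auto
    show "continuous_on (UNIV \<times> {0..T}) (\<lambda>z. - u \<epsilon> z)" if "\<epsilon> > 0" for \<epsilon> T
      by (intro continuous_on_minus uniformly_continuous_imp_continuous
          cauchy_solution_regular(1)[OF u[OF that]])
    show "\<exists>M. \<forall>x. \<forall>t\<in>{0..T}. - u \<epsilon> (x, t) \<le> M" if "\<epsilon> > 0" for \<epsilon> T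
      using cauchy_solution_regular(2)[OF u[OF that]] by (meson abs_le_iff)
    show "- u \<epsilon> (x, 0) = - u0 x" if "\<epsilon> > 0" for \<epsilon> x
      using visc(3)[OF u[OF that]] by simp
    show "viscosity_supersolution (UNIV \<times> {0<..}) (\<lambda>(x, t) r (q, a). a + - Hbar (- q)) (\<lambda>z. - ubar z)"
      by (rule viscosity_supersolution_uminus[OF visc(1)[OF ubar]]) auto
    show "uniformly_continuous_on (UNIV \<times> {0..T}) (\<lambda>z. - ubar z)" for T
      by (rule uniformly_continuous_on_minus[OF cauchy_solution_regular(1)[OF ubar]])
    show "\<exists>M. \<forall>x. \<forall>t\<in>{0..T}. - M \<le> - ubar (x, t)" for T
      using cauchy_solution_regular(2)[OF ubar] by (meson abs_le_iff neg_le_iff_le)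
    show "- ubar (x, 0) = - u0 x" for x
      using visc(3)[OF ubar] by simp
  qed
  show ?thesis
  proof (intro allI impI)
    fix K :: "((real ^ 'd) \<times> real) set" assume "compact K \<and> K \<subseteq> UNIV \<times> {0..}"
    then have K: "compact K" "K \<subseteq> UNIV \<times> {0..}" by auto
    show "uniform_limit K u ubar (at_right 0)"
      unfolding uniform_limit_iff
    proof (intro allI impI)
      fix e :: real assume e: "e > 0"
      from upper.solution_eventually_below_limit[OF K e] lower.solution_eventually_below_limit[OF K e]
      show "\<forall>\<^sub>F \<epsilon> in at_right 0. \<forall>z\<in>K. dist (u \<epsilon> z) (ubar z) < e"
        by eventually_elim (force simp: dist_real_def abs_less_iff)
    qed
  qed
qed

end
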